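(* Let $R$ be a field or $R=\mathbb{Z}$, let $L_R$, $V_R$ be finitely generated $R$-modules, and let $\varphi_R\colon L_R\times L_R\to V_R$ be a skew-symmetric bilinear map. Let $R'$ be a field with $R\subseteq R'$, let $L_{R'}=R'\otimes_R L_R$ and $V_{R'}=R'\otimes_R V_R$ be the modules obtained by extension of scalars, and let $\varphi_{R'}\colon L_{R'}\times L_{R'}\to V_{R'}$ be the induced map. Then $$h(\varphi_R)\le h(\varphi_{R'}).$$
   Context: Submodule means subspace (if the ring is a field) or subgroup (if the ring is $\mathbb{Z}$); rank means dimension or rank of an abelian group, respectively. For a bilinear map $\varphi\colon L\times L\to V$, a submodule $H\subseteq L$ is isotropic if $\varphi(l_1,l_2)=0$ for all $l_1,l_2\in H$; the isotropy index $h(\varphi)$ is the maximum rank of an isotropic submodule of $L$. The induced map is $\varphi_{R'}(\alpha_1\otimes x_1,\alpha_2\otimes x_2)=\alpha_1\alpha_2\otimes\varphi_R(x_1,x_2)$. Skew-symmetric means $\varphi(x,y)=-\varphi(y,x)$ for all $x,y$. $R\subseteq R'$ means $R$ is a subring of $R'$. *)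

theory Defs
  imports "HOL-Algebra.Algebra" "Jordan_Normal_Form.Missing_VectorSpace"
begin

definition finitely_generated_module ::
  "('r, 'm) ring_scheme \<Rightarrow> ('r, 'a, 'n) module_scheme \<Rightarrow> bool" where
  "finitely_generated_module R M \<longleftrightarrow>
     module R M \<and> (\<exists>A. finite A \<and> A \<subseteq> carrier M \<and> LinearCombinations.module.span R M A = carrier M)"

text \<open>Over a field this is the dimension. Otherwise (in the application, over a ring isomorphic to
  the integers) it is the rank of an abelian group: the maximal number of linearly independent
  elements, which does not see torsion.\<close>

definition module_rank ::
  "('r, 'm) ring_scheme \<Rightarrow> ('r, 'a, 'n) module_scheme \<Rightarrow> nat" where
  "module_rank R M =
     (if field R then vectorspace.dim R M
      else Max {card S | S. finite S \<and> S \<subseteq> carrier M \<and> \<not> LinearCombinations.module.lin_dep R M S})"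

definition bilinear_map ::
  "('r, 'm) ring_scheme \<Rightarrow> ('r, 'a, 'n) module_scheme \<Rightarrow> ('r, 'b, 'p) module_scheme
    \<Rightarrow> ('a \<Rightarrow> 'a \<Rightarrow> 'b) \<Rightarrow> bool" where
  "bilinear_map R L V \<phi> \<longleftrightarrow>
     (\<forall>x\<in>carrier L. \<phi> x \<in> module_hom R L V) \<and>
     (\<forall>y\<in>carrier L. (\<lambda>x. \<phi> x y) \<in> module_hom R L V)"

definition skew_symmetric_map ::
  "('r, 'a, 'n) module_scheme \<Rightarrow> ('r, 'b, 'p) module_scheme \<Rightarrow> ('a \<Rightarrow> 'a \<Rightarrow> 'b) \<Rightarrow> bool" where
  "skew_symmetric_map L V \<phi> \<longleftrightarrow>
     (\<forall>x\<in>carrier L. \<forall>y\<in>carrier L. \<phi> x y = \<ominus>\<^bsub>V\<^esub> \<phi> y x)"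

text \<open>Over the integers a submodule is the same as a subgroup.\<close>

definition isotropic_submodule ::
  "('r, 'm) ring_scheme \<Rightarrow> ('r, 'a, 'n) module_scheme \<Rightarrow> ('r, 'b, 'p) module_scheme
    \<Rightarrow> ('a \<Rightarrow> 'a \<Rightarrow> 'b) \<Rightarrow> 'a set \<Rightarrow> bool" where
  "isotropic_submodule R L V \<phi> H \<longleftrightarrow>
     LinearCombinations.submodule R H L \<and> (\<forall>x\<in>H. \<forall>y\<in>H. \<phi> x y = \<zero>\<^bsub>V\<^esub>)"

definition isotropy_index ::
  "('r, 'm) ring_scheme \<Rightarrow> ('r, 'a, 'n) module_scheme \<Rightarrow> ('r, 'b, 'p) module_scheme
    \<Rightarrow> ('a \<Rightarrow> 'a \<Rightarrow> 'b) \<Rightarrow> nat" where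
  "isotropy_index R L V \<phi> =
     Max {module_rank R (L\<lparr>carrier := H\<rparr>) | H. isotropic_submodule R L V \<phi> H}"


section \<open>Extension of scalars\<close>

text \<open>The tensor product of \<open>S\<close> and \<open>M\<close> over a subring \<open>R\<close> of \<open>S\<close> is the quotient of the free
  abelian group on the pairs \<open>(a, x)\<close> by the subgroup generated by the bilinearity and balancing
  relations. Its elements are cosets; \<open>pure_tensor R S M a x\<close> is the coset of \<open>(a, x)\<close>.\<close>

abbreviation tensor_free ::
  "('r, 'k) ring_scheme \<Rightarrow> ('r, 'a, 'n) module_scheme \<Rightarrow> ('r \<times> 'a \<Rightarrow>\<^sub>0 int) monoid" where
  "tensor_free S M \<equiv> free_Abelian_group (carrier S \<times> carrier M)"

definition tensor_relators ::
  "('r, 'm) ring_scheme \<Rightarrow> ('r, 'k) ring_scheme \<Rightarrow> ('r, 'a, 'n) module_scheme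
    \<Rightarrow> ('r \<times> 'a \<Rightarrow>\<^sub>0 int) set" where
  "tensor_relators R S M =
     {frag_of (a \<oplus>\<^bsub>S\<^esub> b, x) - (frag_of (a, x) + frag_of (b, x)) | a b x.
        a \<in> carrier S \<and> b \<in> carrier S \<and> x \<in> carrier M} \<union>
     {frag_of (a, x \<oplus>\<^bsub>M\<^esub> y) - (frag_of (a, x) + frag_of (a, y)) | a x y.
        a \<in> carrier S \<and> x \<in> carrier M \<and> y \<in> carrier M} \<union>
     {frag_of (a \<otimes>\<^bsub>S\<^esub> r, x) - frag_of (a, r \<odot>\<^bsub>M\<^esub> x) | a r x.
        a \<in> carrier S \<and> r \<in> carrier R \<and> x \<in> carrier M}"

definition tensor_null ::
  "('r, 'm) ring_scheme \<Rightarrow> ('r, 'k) ring_scheme \<Rightarrow> ('r, 'a, 'n) module_scheme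
    \<Rightarrow> ('r \<times> 'a \<Rightarrow>\<^sub>0 int) set" where
  "tensor_null R S M = generate (tensor_free S M) (tensor_relators R S M)"

definition pure_tensor ::
  "('r, 'm) ring_scheme \<Rightarrow> ('r, 'k) ring_scheme \<Rightarrow> ('r, 'a, 'n) module_scheme
    \<Rightarrow> 'r \<Rightarrow> 'a \<Rightarrow> ('r \<times> 'a \<Rightarrow>\<^sub>0 int) set" where
  "pure_tensor R S M a x = tensor_null R S M #>\<^bsub>tensor_free S M\<^esub> frag_of (a, x)"

text \<open>The record fields \<open>mult\<close> and \<open>one\<close> are irrelevant for a module. The image of a coset under
  \<open>(b, x) \<mapsto> (a b, x)\<close> need not be a full coset, hence the product with \<open>tensor_null R S M\<close> in
  \<open>smult\<close>; likewise in \<open>induced_map\<close> below.\<close>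

definition scalar_extension ::
  "('r, 'm) ring_scheme \<Rightarrow> ('r, 'k) ring_scheme \<Rightarrow> ('r, 'a, 'n) module_scheme
    \<Rightarrow> ('r, ('r \<times> 'a \<Rightarrow>\<^sub>0 int) set) module" where
  "scalar_extension R S M =
     (let Q = tensor_free S M Mod tensor_null R S M in
       \<lparr>carrier = carrier Q, monoid.mult = undefined, one = undefined,
        ring.zero = one Q, add = monoid.mult Q,
        smult = (\<lambda>a C. tensor_null R S M
          <#>\<^bsub>tensor_free S M\<^esub> frag_extend (\<lambda>(b, x). frag_of (a \<otimes>\<^bsub>S\<^esub> b, x)) ` C)\<rparr>)"

text \<open>The biadditive extension of \<open>((a, x), (b, y)) \<mapsto> (a b, \<phi> x y)\<close> to the free abelian groups,
  and the map it induces on the tensor products.\<close>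

definition free_induced_map ::
  "('r, 'k) ring_scheme \<Rightarrow> ('a \<Rightarrow> 'a \<Rightarrow> 'b)
    \<Rightarrow> ('r \<times> 'a \<Rightarrow>\<^sub>0 int) \<Rightarrow> ('r \<times> 'a \<Rightarrow>\<^sub>0 int) \<Rightarrow> ('r \<times> 'b \<Rightarrow>\<^sub>0 int)" where
  "free_induced_map S \<phi> c d =
     frag_extend (\<lambda>(a, x). frag_extend (\<lambda>(b, y). frag_of (a \<otimes>\<^bsub>S\<^esub> b, \<phi> x y)) d) c"

definition induced_map ::
  "('r, 'm) ring_scheme \<Rightarrow> ('r, 'k) ring_scheme \<Rightarrow> ('r, 'b, 'p) module_scheme \<Rightarrow> ('a \<Rightarrow> 'a \<Rightarrow> 'b)
    \<Rightarrow> ('r \<times> 'a \<Rightarrow>\<^sub>0 int) set \<Rightarrow> ('r \<times> 'a \<Rightarrow>\<^sub>0 int) set \<Rightarrow> ('r \<times> 'b \<Rightarrow>\<^sub>0 int) set" where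
  "induced_map R S V \<phi> C D =
     tensor_null R S V
       <#>\<^bsub>tensor_free S V\<^esub> {free_induced_map S \<phi> c d | c d. c \<in> C \<and> d \<in> D}"


section \<open>Correctness of the construction\<close>

lemma frag_image_generate:
  assumes "c \<in> generate (free_Abelian_group A) Y" "Y \<subseteq> carrier (free_Abelian_group A)"
    and "subgroup T (free_Abelian_group B)"
    and "\<And>u v. f (u + v) = f u + f v" "\<And>x. x \<in> Y \<Longrightarrow> f x \<in> T"
  shows "f c \<in> T"
proof -
  have f0: "f 0 = 0" using assms(4)[of 0 0] by simp
  have fm: "f (- u) = - f u" for u using assms(4)[of u "- u"] f0
    by (simp add: eq_neg_iff_add_eq_0 add.commute)
  have inT: "- t \<in> T" if "t \<in> T" for t
    using subgroup.m_inv_closed[OF assms(3) that] subgroup.mem_carrier[OF assms(3) that] by simp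
  show ?thesis using assms(1)
  proof (induction rule: generate.induct)
    case one
    then show ?case using subgroup.one_closed[OF assms(3)] f0 by simp
  next
    case (inv h)
    then have "inv\<^bsub>free_Abelian_group A\<^esub> h = - h" using assms(2) by auto
    then show ?case using inv fm inT assms(5) by simp
  next
    case (eng h1 h2)
    then show ?case using subgroup.m_closed[OF assms(3)] assms(4) by fastforce
  qed (use assms(5) in auto)
qed

lemma set_mult_coset:
  assumes "group G" "subgroup T G" "z \<in> S" "z \<in> carrier G" "S \<subseteq> T #>\<^bsub>G\<^esub> z"
  shows "T <#>\<^bsub>G\<^esub> S = T #>\<^bsub>G\<^esub> z"
proof -
  interpret group G by fact
  have "T <#>\<^bsub>G\<^esub> S \<subseteq> T <#>\<^bsub>G\<^esub> (T #>\<^bsub>G\<^esub> z)"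
    using assms(5) by (auto simp: set_mult_def)
  also have "\<dots> = T #>\<^bsub>G\<^esub> z"
    using assms(2,4) by (simp add: setmult_rcos_assoc subgroup.subset subgroup_mult_id)
  finally show ?thesis using assms(3) by (force simp: set_mult_def r_coset_def)
qed

lemma frag_coset_iff:
  "d \<in> T #>\<^bsub>free_Abelian_group A\<^esub> c \<longleftrightarrow> d - c \<in> T"
  by (auto simp: r_coset_def intro: bexI[of _ "d - c"])

lemma tensor_relatorsI:
  "a \<in> carrier S \<Longrightarrow> b \<in> carrier S \<Longrightarrow> x \<in> carrier M
    \<Longrightarrow> frag_of (a \<oplus>\<^bsub>S\<^esub> b, x) - (frag_of (a, x) + frag_of (b, x)) \<in> tensor_relators R S M"
  "a \<in> carrier S \<Longrightarrow> x \<in> carrier M \<Longrightarrow> y \<in> carrier M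
    \<Longrightarrow> frag_of (a, x \<oplus>\<^bsub>M\<^esub> y) - (frag_of (a, x) + frag_of (a, y)) \<in> tensor_relators R S M"
  "a \<in> carrier S \<Longrightarrow> r \<in> carrier R \<Longrightarrow> x \<in> carrier M
    \<Longrightarrow> frag_of (a \<otimes>\<^bsub>S\<^esub> r, x) - frag_of (a, r \<odot>\<^bsub>M\<^esub> x) \<in> tensor_relators R S M"
  unfolding tensor_relators_def by blast+

lemma tensor_relatorsE:
  assumes "t \<in> tensor_relators R S M"
  obtains (left) a b x where "a \<in> carrier S" "b \<in> carrier S" "x \<in> carrier M"
      "t = frag_of (a \<oplus>\<^bsub>S\<^esub> b, x) - (frag_of (a, x) + frag_of (b, x))"
  | (right) a x y where "a \<in> carrier S" "x \<in> carrier M" "y \<in> carrier M"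
      "t = frag_of (a, x \<oplus>\<^bsub>M\<^esub> y) - (frag_of (a, x) + frag_of (a, y))"
  | (balanced) a r x where "a \<in> carrier S" "r \<in> carrier R" "x \<in> carrier M"
      "t = frag_of (a \<otimes>\<^bsub>S\<^esub> r, x) - frag_of (a, r \<odot>\<^bsub>M\<^esub> x)"
  using assms unfolding tensor_relators_def by blast

locale scalar_extension_setup = S: cring S + M: module R M
  for S :: "('r, 'k) ring_scheme" and R :: "('r, 'm) ring_scheme"
    and M :: "('r, 'a, 'n) module_scheme" +
  assumes carrier_subset: "carrier R \<subseteq> carrier S"
begin

abbreviation "F \<equiv> tensor_free S M"
abbreviation "T \<equiv> tensor_null R S M"
abbreviation "E \<equiv> scalar_extension R S M"
abbreviation "cl c \<equiv> T #>\<^bsub>F\<^esub> c"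
abbreviation "act a \<equiv> frag_extend (\<lambda>(b, x). frag_of (a \<otimes>\<^bsub>S\<^esub> b, x))"

sublocale F: comm_group F by (rule abelian_free_Abelian_group)

lemma R_in_S: "r \<in> carrier R \<Longrightarrow> r \<in> carrier S"
  using carrier_subset by blast

lemma relators_carrier: "tensor_relators R S M \<subseteq> carrier F"
proof -
  have *: "c - d \<in> carrier F" if "c \<in> carrier F" "d \<in> carrier F" for c d
    using that keys_diff[of c d] by auto
  have **: "c + d \<in> carrier F" if "c \<in> carrier F" "d \<in> carrier F" for c d
    using F.m_closed[OF that] by simp
  show ?thesis
  proof
    fix t assume "t \<in> tensor_relators R S M"
    then show "t \<in> carrier F"
    proof (cases rule: tensor_relatorsE)
      case left
      show ?thesis unfolding left(4) by (intro * **) (use left in simp_all)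
    next
      case right
      show ?thesis unfolding right(4) by (intro * **) (use right in simp_all)
    next
      case balanced
      show ?thesis unfolding balanced(4) by (intro *) (use balanced in \<open>simp_all add: R_in_S\<close>)
    qed
  qed
qed

lemma T_subgroup: "subgroup T F"
  unfolding tensor_null_def by (rule F.generate_is_subgroup[OF relators_carrier])

lemma T_normal: "T \<lhd> F"
  using T_subgroup F.normal_iff_subgroup by blast

lemma T_relator: "c \<in> tensor_relators R S M \<Longrightarrow> c \<in> T"
  unfolding tensor_null_def by (rule generate.incl)

lemma cl_eq: "c - d \<in> T \<Longrightarrow> d \<in> carrier F \<Longrightarrow> cl c = cl d"
  using F.repr_independence[of c T d] T_subgroup by (simp add: frag_coset_iff del: carrier_free_Abelian_group_iff)

lemma E_simps [simp]:
  "carrier E = carrier (F Mod T)" "\<zero>\<^bsub>E\<^esub> = T" "add E = monoid.mult (F Mod T)"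
  "smult E = (\<lambda>a C. T <#>\<^bsub>F\<^esub> act a ` C)"
  by (simp_all add: scalar_extension_def Let_def FactGroup_def)

lemma E_cases:
  assumes "C \<in> carrier E" obtains c where "c \<in> carrier F" "C = cl c"
  using assms by (auto simp: FactGroup_def RCOSETS_def simp del: carrier_free_Abelian_group_iff)

lemma cl_closed: "c \<in> carrier F \<Longrightarrow> cl c \<in> carrier E"
  by (auto simp: FactGroup_def RCOSETS_def simp del: carrier_free_Abelian_group_iff)

lemma cl_add: "c \<in> carrier F \<Longrightarrow> d \<in> carrier F \<Longrightarrow> cl c \<oplus>\<^bsub>E\<^esub> cl d = cl (c + d)"
  using normal.rcos_sum[OF T_normal, of c d] by (simp add: FactGroup_def)

lemma act_closed: "a \<in> carrier S \<Longrightarrow> c \<in> carrier F \<Longrightarrow> act a c \<in> carrier F"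
  unfolding carrier_free_Abelian_group_iff
  by (rule order_trans[OF keys_frag_extend]) auto

lemma act_T:
  assumes "a \<in> carrier S" "c \<in> T" shows "act a c \<in> T"
proof (rule frag_image_generate[OF assms(2)[unfolded tensor_null_def] relators_carrier T_subgroup])
  fix t assume "t \<in> tensor_relators R S M"
  then have "act a t \<in> tensor_relators R S M"
  proof (cases rule: tensor_relatorsE)
    case (left b c x)
    then show ?thesis using assms(1) tensor_relatorsI(1)[of "a \<otimes>\<^bsub>S\<^esub> b" S "a \<otimes>\<^bsub>S\<^esub> c" x M R]
      by (simp add: frag_extend_diff frag_extend_add S.r_distr)
  next
    case (right b x y)
    then show ?thesis using assms(1) tensor_relatorsI(2)[of "a \<otimes>\<^bsub>S\<^esub> b" S x M y R]
      by (simp add: frag_extend_diff frag_extend_add)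
  next
    case (balanced b r x)
    then show ?thesis using assms(1) tensor_relatorsI(3)[of "a \<otimes>\<^bsub>S\<^esub> b" S r R x M]
      by (simp add: frag_extend_diff S.m_assoc R_in_S)
  qed
  then show "act a t \<in> T" by (rule T_relator)
qed (simp add: frag_extend_add)

lemma smult_cl:
  assumes "a \<in> carrier S" "c \<in> carrier F"
  shows "a \<odot>\<^bsub>E\<^esub> cl c = cl (act a c)"
proof -
  have "act a ` cl c \<subseteq> cl (act a c)"
    using act_T[OF assms(1)] by (auto simp: frag_coset_iff simp flip: frag_extend_diff)
  moreover have "c \<in> cl c" using F.rcos_self[OF assms(2) T_subgroup] .
  ultimately show ?thesis
    unfolding E_simps
    by (intro set_mult_coset F.group_axioms T_subgroup act_closed assms) auto
qed

lemma pure_tensor_eq: "pure_tensor R S M a x = cl (frag_of (a, x))"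
  by (simp add: pure_tensor_def)

lemma frag_carrier: "a \<in> carrier S \<Longrightarrow> x \<in> carrier M \<Longrightarrow> frag_of (a, x) \<in> carrier F"
  by simp

lemma add_carrier: "c \<in> carrier F \<Longrightarrow> d \<in> carrier F \<Longrightarrow> c + d \<in> carrier F"
  using F.m_closed[of c d] by simp

lemma pure_tensor_closed:
  "a \<in> carrier S \<Longrightarrow> x \<in> carrier M \<Longrightarrow> pure_tensor R S M a x \<in> carrier E"
  unfolding pure_tensor_eq by (intro cl_closed frag_carrier)

lemma pure_tensor_add_left:
  assumes "a \<in> carrier S" "b \<in> carrier S" "x \<in> carrier M"
  shows "pure_tensor R S M (a \<oplus>\<^bsub>S\<^esub> b) x = pure_tensor R S M a x \<oplus>\<^bsub>E\<^esub> pure_tensor R S M b x"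
  unfolding pure_tensor_eq cl_add[OF frag_carrier[OF assms(1,3)] frag_carrier[OF assms(2,3)]]
  by (intro cl_eq T_relator add_carrier frag_carrier assms)
    (rule tensor_relatorsI(1)[OF assms])

lemma pure_tensor_add_right:
  assumes "a \<in> carrier S" "x \<in> carrier M" "y \<in> carrier M"
  shows "pure_tensor R S M a (x \<oplus>\<^bsub>M\<^esub> y) = pure_tensor R S M a x \<oplus>\<^bsub>E\<^esub> pure_tensor R S M a y"
  unfolding pure_tensor_eq cl_add[OF frag_carrier[OF assms(1,2)] frag_carrier[OF assms(1,3)]]
  by (intro cl_eq T_relator add_carrier frag_carrier assms)
    (rule tensor_relatorsI(2)[OF assms])

lemma pure_tensor_balanced:
  assumes "a \<in> carrier S" "r \<in> carrier R" "x \<in> carrier M"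
  shows "pure_tensor R S M (a \<otimes>\<^bsub>S\<^esub> r) x = pure_tensor R S M a (r \<odot>\<^bsub>M\<^esub> x)"
  unfolding pure_tensor_eq
  by (intro cl_eq T_relator frag_carrier assms M.smult_closed)
    (rule tensor_relatorsI(3)[OF assms])

lemma smult_pure_tensor:
  assumes "a \<in> carrier S" "b \<in> carrier S" "x \<in> carrier M"
  shows "a \<odot>\<^bsub>E\<^esub> pure_tensor R S M b x = pure_tensor R S M (a \<otimes>\<^bsub>S\<^esub> b) x"
  unfolding pure_tensor_eq by (simp only: smult_cl[OF assms(1) frag_carrier[OF assms(2,3)]] frag_extend_of prod.case)

lemma act_add_left:
  assumes "a \<in> carrier S" "b \<in> carrier S" "c \<in> carrier F"
  shows "act (a \<oplus>\<^bsub>S\<^esub> b) c - (act a c + act b c) \<in> T"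
proof -
  have k: "Poly_Mapping.keys c \<subseteq> carrier S \<times> carrier M" using assms(3) by simp
  show ?thesis using k
  proof (induction c rule: frag_induction)
    case zero
    then show ?case using subgroup.one_closed[OF T_subgroup] by simp
  next
    case (one p)
    then obtain e x where p: "p = (e, x)" "e \<in> carrier S" "x \<in> carrier M" by (cases p) auto
    show ?case unfolding p(1)
      using T_relator[OF tensor_relatorsI(1)[of "a \<otimes>\<^bsub>S\<^esub> e" S "b \<otimes>\<^bsub>S\<^esub> e" x M R]] p assms
      by (simp add: S.l_distr)
  next
    case (diff c d)
    have "u - v \<in> T" if "u \<in> T" "v \<in> T" for u v
      using subgroup.m_closed[OF T_subgroup that(1) subgroup.m_inv_closed[OF T_subgroup that(2)]]
        subgroup.mem_carrier[OF T_subgroup that(2)] by simp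
    from this[OF diff] show ?case by (simp add: frag_extend_diff algebra_simps)
  qed
qed

lemma act_assoc:
  assumes "a \<in> carrier S" "b \<in> carrier S" "c \<in> carrier F"
  shows "act (a \<otimes>\<^bsub>S\<^esub> b) c = act a (act b c)"
proof -
  have k: "Poly_Mapping.keys c \<subseteq> carrier S \<times> carrier M" using assms(3) by simp
  show ?thesis using k
    by (induction c rule: frag_induction) (use assms in \<open>auto simp: frag_extend_diff S.m_assoc\<close>)
qed

lemma act_one:
  assumes "c \<in> carrier F" shows "act \<one>\<^bsub>S\<^esub> c = c"
proof -
  have k: "Poly_Mapping.keys c \<subseteq> carrier S \<times> carrier M" using assms by simp
  show ?thesis using k
    by (induction c rule: frag_induction) (auto simp: frag_extend_diff)
qed

theorem scalar_extension_module: "module S E"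
proof (rule moduleI)
  show "cring S" by (rule S.cring_axioms)
  interpret Q: comm_group "F Mod T" using F.abelian_FactGroup[OF T_subgroup] .
  have one: "\<one>\<^bsub>F Mod T\<^esub> = T" by (simp add: FactGroup_def)
  note Q_one = Q.one_closed[unfolded one] Q.l_one[unfolded one] Q.l_inv[unfolded one]
  show "abelian_group E"
  proof (rule abelian_groupI)
    fix C assume "C \<in> carrier E"
    then show "\<exists>D\<in>carrier E. D \<oplus>\<^bsub>E\<^esub> C = \<zero>\<^bsub>E\<^esub>"
      unfolding E_simps using Q.inv_closed Q_one(3) by blast
  qed (unfold E_simps, (rule Q.m_closed Q_one(1,2) Q.m_assoc Q.m_comm; assumption)+)
next
  fix a C assume a: "a \<in> carrier S" and "C \<in> carrier E"
  then obtain c where c: "c \<in> carrier F" "C = cl c" by (rule_tac E_cases)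
  show "a \<odot>\<^bsub>E\<^esub> C \<in> carrier E" unfolding c smult_cl[OF a c(1)]
    by (intro cl_closed act_closed a c)
next
  fix a b C assume a: "a \<in> carrier S" "b \<in> carrier S" and "C \<in> carrier E"
  then obtain c where c: "c \<in> carrier F" "C = cl c" by (rule_tac E_cases)
  show "(a \<oplus>\<^bsub>S\<^esub> b) \<odot>\<^bsub>E\<^esub> C = a \<odot>\<^bsub>E\<^esub> C \<oplus>\<^bsub>E\<^esub> b \<odot>\<^bsub>E\<^esub> C"
    unfolding c smult_cl[OF a(1) c(1)] smult_cl[OF a(2) c(1)] smult_cl[OF S.a_closed[OF a] c(1)]
      cl_add[OF act_closed[OF a(1) c(1)] act_closed[OF a(2) c(1)]]
    by (intro cl_eq act_add_left add_carrier act_closed a c)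
  show "(a \<otimes>\<^bsub>S\<^esub> b) \<odot>\<^bsub>E\<^esub> C = a \<odot>\<^bsub>E\<^esub> (b \<odot>\<^bsub>E\<^esub> C)"
    unfolding c smult_cl[OF a(2) c(1)] smult_cl[OF S.m_closed[OF a] c(1)]
      smult_cl[OF a(1) act_closed[OF a(2) c(1)]] act_assoc[OF a c(1)] ..
next
  fix a C D assume a: "a \<in> carrier S" and "C \<in> carrier E" "D \<in> carrier E"
  then obtain c d where c: "c \<in> carrier F" "C = cl c" and d: "d \<in> carrier F" "D = cl d"
    by (metis E_cases)
  show "a \<odot>\<^bsub>E\<^esub> (C \<oplus>\<^bsub>E\<^esub> D) = a \<odot>\<^bsub>E\<^esub> C \<oplus>\<^bsub>E\<^esub> a \<odot>\<^bsub>E\<^esub> D"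
    unfolding c d cl_add[OF c(1) d(1)] smult_cl[OF a c(1)] smult_cl[OF a d(1)]
      smult_cl[OF a add_carrier[OF c(1) d(1)]] cl_add[OF act_closed[OF a c(1)] act_closed[OF a d(1)]]
      frag_extend_add ..
next
  fix C assume "C \<in> carrier E"
  then obtain c where c: "c \<in> carrier F" "C = cl c" by (rule_tac E_cases)
  show "\<one>\<^bsub>S\<^esub> \<odot>\<^bsub>E\<^esub> C = C"
    unfolding c smult_cl[OF S.one_closed c(1)] act_one[OF c(1)] ..
qed

end

locale induced_map_setup =
  L: scalar_extension_setup S R L + V: scalar_extension_setup S R V
  for S :: "('r, 'k) ring_scheme" and R :: "('r, 'm) ring_scheme"
    and L :: "('r, 'a, 'n) module_scheme" and V :: "('r, 'b, 'p) module_scheme" +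
  fixes \<phi> :: "'a \<Rightarrow> 'a \<Rightarrow> 'b"
  assumes bilinear: "bilinear_map R L V \<phi>"
begin

abbreviation "\<Phi> \<equiv> free_induced_map S \<phi>"
abbreviation "\<psi> \<equiv> induced_map R S V \<phi>"

lemma \<phi>_simps:
  "x \<in> carrier L \<Longrightarrow> y \<in> carrier L \<Longrightarrow> \<phi> x y \<in> carrier V"
  "x \<in> carrier L \<Longrightarrow> y \<in> carrier L \<Longrightarrow> z \<in> carrier L \<Longrightarrow> \<phi> x (y \<oplus>\<^bsub>L\<^esub> z) = \<phi> x y \<oplus>\<^bsub>V\<^esub> \<phi> x z"
  "x \<in> carrier L \<Longrightarrow> y \<in> carrier L \<Longrightarrow> z \<in> carrier L \<Longrightarrow> \<phi> (x \<oplus>\<^bsub>L\<^esub> y) z = \<phi> x z \<oplus>\<^bsub>V\<^esub> \<phi> y z"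
  "r \<in> carrier R \<Longrightarrow> x \<in> carrier L \<Longrightarrow> y \<in> carrier L \<Longrightarrow> \<phi> x (r \<odot>\<^bsub>L\<^esub> y) = r \<odot>\<^bsub>V\<^esub> \<phi> x y"
  "r \<in> carrier R \<Longrightarrow> x \<in> carrier L \<Longrightarrow> y \<in> carrier L \<Longrightarrow> \<phi> (r \<odot>\<^bsub>L\<^esub> x) y = r \<odot>\<^bsub>V\<^esub> \<phi> x y"
  using bilinear unfolding bilinear_map_def module_hom_def by auto

lemma \<Phi>_add_left: "\<Phi> (c + c') d = \<Phi> c d + \<Phi> c' d"
  by (simp add: free_induced_map_def frag_extend_add)

lemma \<Phi>_diff_left: "\<Phi> (c - c') d = \<Phi> c d - \<Phi> c' d"
  by (simp add: free_induced_map_def frag_extend_diff)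

lemma \<Phi>_frag_left: "\<Phi> (frag_of (a, x)) d = frag_extend (\<lambda>(b, y). frag_of (a \<otimes>\<^bsub>S\<^esub> b, \<phi> x y)) d"
  by (simp add: free_induced_map_def)

lemma \<Phi>_diff_right: "\<Phi> c (d - d') = \<Phi> c d - \<Phi> c d'"
proof (induction c rule: frag_induction[OF subset_UNIV])
  case 1 show ?case by (simp add: free_induced_map_def)
next
  case (2 p) show ?case by (cases p) (simp add: \<Phi>_frag_left frag_extend_diff)
next
  case 3 then show ?case by (simp add: \<Phi>_diff_left)
qed

lemma \<Phi>_add_right: "\<Phi> c (d + d') = \<Phi> c d + \<Phi> c d'"
  using \<Phi>_diff_right[of c "d + d'" d'] by simp

lemma \<Phi>_zero [simp]: "\<Phi> 0 d = 0" "\<Phi> c 0 = 0"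
  using \<Phi>_diff_left[of 0 0] \<Phi>_diff_right[of _ 0 0] by simp_all

lemma diff_carrier: "u \<in> carrier V.F \<Longrightarrow> v \<in> carrier V.F \<Longrightarrow> u - v \<in> carrier V.F"
  using keys_diff[of u v] by auto

lemma VT_diff: "u \<in> V.T \<Longrightarrow> v \<in> V.T \<Longrightarrow> u - v \<in> V.T"
  using subgroup.m_closed[OF V.T_subgroup, of u "- v"] subgroup.m_inv_closed[OF V.T_subgroup, of v]
    subgroup.mem_carrier[OF V.T_subgroup, of v] by simp

lemma VT_zero: "0 \<in> V.T"
  using subgroup.one_closed[OF V.T_subgroup] by simp

lemma \<Phi>_closed:
  assumes "c \<in> carrier L.F" "d \<in> carrier L.F"
  shows "\<Phi> c d \<in> carrier V.F"
proof -
  have kc: "Poly_Mapping.keys c \<subseteq> carrier S \<times> carrier L"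
    and kd: "Poly_Mapping.keys d \<subseteq> carrier S \<times> carrier L" using assms by simp_all
  have 1: "\<Phi> (frag_of p) d \<in> carrier V.F" if p: "p \<in> carrier S \<times> carrier L" for p
    using kd
  proof (induction d rule: frag_induction)
    case (one q)
    then show ?case using p by (cases p; cases q) (auto simp: \<Phi>_frag_left \<phi>_simps)
  next
    case (diff d e)
    then show ?case unfolding \<Phi>_diff_right by (intro diff_carrier)
  qed simp
  show ?thesis using kc
  proof (induction c rule: frag_induction)
    case (diff c c')
    then show ?case unfolding \<Phi>_diff_left by (intro diff_carrier)
  qed (use 1 in \<open>simp_all del: carrier_free_Abelian_group_iff\<close>, simp)
qed

lemma \<Phi>_T_left:
  assumes "c \<in> L.T" "d \<in> carrier L.F"
  shows "\<Phi> c d \<in> V.T"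
proof (rule frag_image_generate[OF assms(1)[unfolded tensor_null_def] L.relators_carrier V.T_subgroup,
      where f = "\<lambda>c. \<Phi> c d"])
  fix t assume t: "t \<in> tensor_relators R S L"
  have kd: "Poly_Mapping.keys d \<subseteq> carrier S \<times> carrier L" using assms by simp
  show "\<Phi> t d \<in> V.T" using kd
  proof (induction d rule: frag_induction)
    case zero then show ?case using VT_zero by simp
  next
    case (one q)
    then obtain b y where q: "q = (b, y)" "b \<in> carrier S" "y \<in> carrier L" by (cases q) auto
    from t have "\<Phi> t (frag_of q) \<in> tensor_relators R S V"
    proof (cases rule: tensor_relatorsE)
      case (left a c x)
      then show ?thesis
        using q tensor_relatorsI(1)[of "a \<otimes>\<^bsub>S\<^esub> b" S "c \<otimes>\<^bsub>S\<^esub> b" "\<phi> x y" V R]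
        by (simp add: \<Phi>_diff_left \<Phi>_add_left \<Phi>_frag_left L.S.l_distr \<phi>_simps)
    next
      case (right a x z)
      then show ?thesis
        using q tensor_relatorsI(2)[of "a \<otimes>\<^bsub>S\<^esub> b" S "\<phi> x y" V "\<phi> z y" R]
        by (simp add: \<Phi>_diff_left \<Phi>_add_left \<Phi>_frag_left \<phi>_simps)
    next
      case (balanced a r x)
      moreover have "a \<otimes>\<^bsub>S\<^esub> b \<otimes>\<^bsub>S\<^esub> r = a \<otimes>\<^bsub>S\<^esub> r \<otimes>\<^bsub>S\<^esub> b"
        using balanced q by (simp add: L.S.m_assoc L.S.m_comm[of b r] L.R_in_S)
      ultimately show ?thesis
        using q tensor_relatorsI(3)[of "a \<otimes>\<^bsub>S\<^esub> b" S r R "\<phi> x y" V]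
        by (simp add: \<Phi>_diff_left \<Phi>_frag_left \<phi>_simps)
    qed
    then show ?case by (rule V.T_relator)
  next
    case (diff d e)
    then show ?case unfolding \<Phi>_diff_right by (intro VT_diff)
  qed
qed (rule \<Phi>_add_left)

lemma \<Phi>_T_right:
  assumes "c \<in> carrier L.F" "d \<in> L.T"
  shows "\<Phi> c d \<in> V.T"
proof (rule frag_image_generate[OF assms(2)[unfolded tensor_null_def] L.relators_carrier V.T_subgroup,
      where f = "\<Phi> c"])
  fix t assume t: "t \<in> tensor_relators R S L"
  have kc: "Poly_Mapping.keys c \<subseteq> carrier S \<times> carrier L" using assms by simp
  show "\<Phi> c t \<in> V.T" using kc
  proof (induction c rule: frag_induction)
    case zero then show ?case using VT_zero by simp
  next
    case (one q)
    then obtain b y where q: "q = (b, y)" "b \<in> carrier S" "y \<in> carrier L" by (cases q) auto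
    from t have "\<Phi> (frag_of q) t \<in> tensor_relators R S V"
    proof (cases rule: tensor_relatorsE)
      case (left a c x)
      then show ?thesis
        using q tensor_relatorsI(1)[of "b \<otimes>\<^bsub>S\<^esub> a" S "b \<otimes>\<^bsub>S\<^esub> c" "\<phi> y x" V R]
        by (simp add: \<Phi>_diff_right \<Phi>_add_right \<Phi>_frag_left L.S.r_distr \<phi>_simps)
    next
      case (right a x z)
      then show ?thesis
        using q tensor_relatorsI(2)[of "b \<otimes>\<^bsub>S\<^esub> a" S "\<phi> y x" V "\<phi> y z" R]
        by (simp add: \<Phi>_diff_right \<Phi>_add_right \<Phi>_frag_left \<phi>_simps)
    next
      case (balanced a r x)
      then show ?thesis
        using q tensor_relatorsI(3)[of "b \<otimes>\<^bsub>S\<^esub> a" S r R "\<phi> y x" V]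
        by (simp add: \<Phi>_diff_right \<Phi>_frag_left \<phi>_simps L.S.m_assoc L.R_in_S)
    qed
    then show ?case by (rule V.T_relator)
  next
    case (diff d e)
    then show ?case unfolding \<Phi>_diff_left by (intro VT_diff)
  qed
qed (rule \<Phi>_add_right)

lemma induced_map_cl:
  assumes c: "c \<in> carrier L.F" and d: "d \<in> carrier L.F"
  shows "\<psi> (L.cl c) (L.cl d) = V.cl (\<Phi> c d)"
  unfolding induced_map_def
proof (rule set_mult_coset[OF V.F.group_axioms V.T_subgroup])
  show "\<Phi> c d \<in> {\<Phi> c' d' | c' d'. c' \<in> L.cl c \<and> d' \<in> L.cl d}"
    using L.F.rcos_self[OF c L.T_subgroup] L.F.rcos_self[OF d L.T_subgroup] by blast
  show "\<Phi> c d \<in> carrier V.F" using \<Phi>_closed assms .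
  have "\<Phi> c' d' \<in> V.cl (\<Phi> c d)" if "c' \<in> L.cl c" "d' \<in> L.cl d" for c' d'
  proof -
    have *: "c' - c \<in> L.T" "d' - d \<in> L.T" using that by (simp_all add: frag_coset_iff)
    have "d' = d + (d' - d)" by simp
    then have d': "d' \<in> carrier L.F"
      by (metis * (2) L.add_carrier d subgroup.mem_carrier[OF L.T_subgroup])
    have "\<Phi> c' d' - \<Phi> c d = \<Phi> (c' - c) d' - \<Phi> c (d - d')"
      by (simp add: \<Phi>_diff_left \<Phi>_diff_right)
    also have "\<Phi> c (d - d') = 0 - \<Phi> c (d' - d)"
      by (simp add: \<Phi>_diff_right)
    finally show ?thesis
      unfolding frag_coset_iff by (simp only:) (intro VT_diff VT_zero \<Phi>_T_left \<Phi>_T_right * c d')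
  qed
  then show "{\<Phi> c' d' | c' d'. c' \<in> L.cl c \<and> d' \<in> L.cl d} \<subseteq> V.cl (\<Phi> c d)" by blast
qed

theorem induced_map_pure_tensor:
  assumes "a \<in> carrier S" "x \<in> carrier L" "b \<in> carrier S" "y \<in> carrier L"
  shows "\<psi> (pure_tensor R S L a x) (pure_tensor R S L b y) = pure_tensor R S V (a \<otimes>\<^bsub>S\<^esub> b) (\<phi> x y)"
  using induced_map_cl[OF L.frag_carrier[OF assms(1,2)] L.frag_carrier[OF assms(3,4)]]
  by (simp add: pure_tensor_def \<Phi>_frag_left)

lemma \<Phi>_act:
  assumes a: "a \<in> carrier S" and c: "c \<in> carrier L.F" and d: "d \<in> carrier L.F"
  shows "\<Phi> (L.act a c) d = V.act a (\<Phi> c d)" "\<Phi> c (L.act a d) = V.act a (\<Phi> c d)"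
proof -
  have kc: "Poly_Mapping.keys c \<subseteq> carrier S \<times> carrier L"
    and kd: "Poly_Mapping.keys d \<subseteq> carrier S \<times> carrier L" using assms by simp_all
  have 1: "\<Phi> (L.act a (frag_of p)) d = V.act a (\<Phi> (frag_of p) d) \<and>
           \<Phi> (frag_of p) (L.act a d) = V.act a (\<Phi> (frag_of p) d)"
    if p: "p \<in> carrier S \<times> carrier L" for p
    using kd
  proof (induction d rule: frag_induction)
    case (one q)
    then show ?case using p a
      by (cases p; cases q) (auto simp: \<Phi>_frag_left L.S.m_assoc L.S.m_lcomm)
  qed (auto simp: frag_extend_diff \<Phi>_diff_right)
  have "\<Phi> (L.act a c) d = V.act a (\<Phi> c d) \<and> \<Phi> c (L.act a d) = V.act a (\<Phi> c d)" using kc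
    by (induction c rule: frag_induction) (auto simp: frag_extend_diff \<Phi>_diff_left 1 simp del: frag_extend_of)
  then show "\<Phi> (L.act a c) d = V.act a (\<Phi> c d)" "\<Phi> c (L.act a d) = V.act a (\<Phi> c d)" by simp_all
qed

theorem induced_map_bilinear: "bilinear_map S L.E V.E \<psi>"
proof -
  have 1: "\<psi> C D \<in> carrier V.E" if CD: "C \<in> carrier L.E" "D \<in> carrier L.E" for C D
  proof -
    obtain c d where c: "c \<in> carrier L.F" "C = L.cl c" and d: "d \<in> carrier L.F" "D = L.cl d"
      using CD by (metis L.E_cases)
    show ?thesis unfolding c d induced_map_cl[OF c(1) d(1)]
      by (intro V.cl_closed \<Phi>_closed c d)
  qed
  have 2: "\<psi> C (D \<oplus>\<^bsub>L.E\<^esub> D') = \<psi> C D \<oplus>\<^bsub>V.E\<^esub> \<psi> C D'" "\<psi> (D \<oplus>\<^bsub>L.E\<^esub> D') C = \<psi> D C \<oplus>\<^bsub>V.E\<^esub> \<psi> D' C"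
    if CD: "C \<in> carrier L.E" "D \<in> carrier L.E" "D' \<in> carrier L.E" for C D D'
  proof -
    obtain c d d' where c: "c \<in> carrier L.F" "C = L.cl c" and d: "d \<in> carrier L.F" "D = L.cl d"
      and d': "d' \<in> carrier L.F" "D' = L.cl d'"
      using CD by (metis L.E_cases)
    note i = L.add_carrier[OF d(1) d'(1)]
    show "\<psi> C (D \<oplus>\<^bsub>L.E\<^esub> D') = \<psi> C D \<oplus>\<^bsub>V.E\<^esub> \<psi> C D'"
      unfolding c d d' L.cl_add[OF d(1) d'(1)] induced_map_cl[OF c(1) i]
        induced_map_cl[OF c(1) d(1)] induced_map_cl[OF c(1) d'(1)] \<Phi>_add_right
        V.cl_add[OF \<Phi>_closed[OF c(1) d(1)] \<Phi>_closed[OF c(1) d'(1)]] ..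
    show "\<psi> (D \<oplus>\<^bsub>L.E\<^esub> D') C = \<psi> D C \<oplus>\<^bsub>V.E\<^esub> \<psi> D' C"
      unfolding c d d' L.cl_add[OF d(1) d'(1)] induced_map_cl[OF i c(1)]
        induced_map_cl[OF d(1) c(1)] induced_map_cl[OF d'(1) c(1)] \<Phi>_add_left
        V.cl_add[OF \<Phi>_closed[OF d(1) c(1)] \<Phi>_closed[OF d'(1) c(1)]] ..
  qed
  have 3: "\<psi> C (a \<odot>\<^bsub>L.E\<^esub> D) = a \<odot>\<^bsub>V.E\<^esub> \<psi> C D" "\<psi> (a \<odot>\<^bsub>L.E\<^esub> C) D = a \<odot>\<^bsub>V.E\<^esub> \<psi> C D"
    if a: "a \<in> carrier S" and CD: "C \<in> carrier L.E" "D \<in> carrier L.E" for a C D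
  proof -
    obtain c d where c: "c \<in> carrier L.F" "C = L.cl c" and d: "d \<in> carrier L.F" "D = L.cl d"
      using CD by (metis L.E_cases)
    show "\<psi> C (a \<odot>\<^bsub>L.E\<^esub> D) = a \<odot>\<^bsub>V.E\<^esub> \<psi> C D"
      unfolding c d L.smult_cl[OF a d(1)] induced_map_cl[OF c(1) d(1)]
        induced_map_cl[OF c(1) L.act_closed[OF a d(1)]] V.smult_cl[OF a \<Phi>_closed[OF c(1) d(1)]]
        \<Phi>_act[OF a c(1) d(1)] ..
    show "\<psi> (a \<odot>\<^bsub>L.E\<^esub> C) D = a \<odot>\<^bsub>V.E\<^esub> \<psi> C D"
      unfolding c d L.smult_cl[OF a c(1)] induced_map_cl[OF c(1) d(1)]
        induced_map_cl[OF L.act_closed[OF a c(1)] d(1)] V.smult_cl[OF a \<Phi>_closed[OF c(1) d(1)]]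
        \<Phi>_act[OF a c(1) d(1)] ..
  qed
  show ?thesis
    unfolding bilinear_map_def module_hom_def using 1 2 3 by (auto simp del: L.E_simps V.E_simps)
qed

end

end

theory Submission
  imports Defs
begin

text \<open>Both isotropy indices count independent vectors: \<open>h(\<phi>)\<close> is the largest size of a linearly
  independent set of vectors on which \<open>\<phi>\<close> vanishes pairwise, because the span of such a set is
  isotropic (\<open>isotropy_index_is_max_lin_indpt\<close>). For a vanishing set \<open>B\<close> in \<open>L\<close>, the vectors
  \<open>1 \<otimes> x\<close> with \<open>x \<in> B\<close> again annihilate each other, since the induced map sends the pair
  \<open>1 \<otimes> x\<close>, \<open>1 \<otimes> y\<close> to \<open>1 \<otimes> \<phi> x y\<close>. So it is enough that \<open>x \<mapsto> 1 \<otimes> x\<close> is injective on \<open>B\<close> and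
  preserves its linear independence (\<open>pure_tensors_lin_indpt\<close>).

  This is a consequence of flatness of \<open>R'\<close> over \<open>R\<close>, but it can be seen by hand: it suffices to
  find, for every \<open>s \<in> B\<close>, a linear form on the extended module that is 1 at \<open>1 \<otimes> s\<close> and 0 at the
  other vectors \<open>1 \<otimes> t\<close>. Such a form is induced by an \<open>R\<close>-linear map \<open>f: L \<rightarrow> R'\<close> with \<open>f s = 1\<close> and
  \<open>f t = 0\<close>, as \<open>a \<otimes> x \<mapsto> a (f x)\<close>. By independence \<open>f\<close> can be prescribed on the span
  of \<open>B\<close>, and it extends to \<open>L\<close> because \<open>R'\<close> is an injective \<open>R\<close>-module: it contains the
  quotients needed to choose the value at one further generator (\<open>extend_linear_form\<close>). This
  argument treats fields and the integers alike, and torsion in \<open>L\<close> does no harm: it is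
  simply sent to 0.

  The vectors \<open>1 \<otimes> a\<close>, for \<open>a\<close> in a finite generating set of \<open>L\<close>, span the extended module and hence
  bound the size of every independent set in it, and therefore also in \<open>L\<close>. This
  guarantees that all the maxima in question are attained.\<close>


section \<open>Linear forms with values in a larger ring\<close>

text \<open>These are the homomorphisms of \<open>R\<close>-modules from the submodule \<open>N\<close> of \<open>M\<close> to \<open>S\<close>. A predicate
  on functions avoids turning the ring \<open>S\<close> into a module record over \<open>R\<close>, and it also covers the
  ordinary linear forms as the case \<open>R = S\<close>.\<close>

definition linear_form ::
  "('r, 'm) ring_scheme \<Rightarrow> ('r, 'k) ring_scheme \<Rightarrow> ('r, 'a, 'n) module_scheme \<Rightarrow> 'a set
    \<Rightarrow> ('a \<Rightarrow> 'r) \<Rightarrow> bool" where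
  "linear_form R S M N f \<longleftrightarrow> f \<in> N \<rightarrow> carrier S
    \<and> (\<forall>x\<in>N. \<forall>y\<in>N. f (x \<oplus>\<^bsub>M\<^esub> y) = f x \<oplus>\<^bsub>S\<^esub> f y)
    \<and> (\<forall>r\<in>carrier R. \<forall>x\<in>N. f (r \<odot>\<^bsub>M\<^esub> x) = r \<otimes>\<^bsub>S\<^esub> f x)"

lemma linear_formD:
  assumes "linear_form R S M N f"
  shows "x \<in> N \<Longrightarrow> f x \<in> carrier S"
    and "x \<in> N \<Longrightarrow> y \<in> N \<Longrightarrow> f (x \<oplus>\<^bsub>M\<^esub> y) = f x \<oplus>\<^bsub>S\<^esub> f y"
    and "r \<in> carrier R \<Longrightarrow> x \<in> N \<Longrightarrow> f (r \<odot>\<^bsub>M\<^esub> x) = r \<otimes>\<^bsub>S\<^esub> f x"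
  using assms unfolding linear_form_def by auto

lemma (in ring) idem_add_zero: "a \<in> carrier R \<Longrightarrow> a \<oplus> a = a \<Longrightarrow> a = \<zero>"
  by (metis add.l_cancel_one)

lemma linear_form_zero:
  assumes "ring S" "submodule R N M" "linear_form R S M N f"
  shows "f \<zero>\<^bsub>M\<^esub> = \<zero>\<^bsub>S\<^esub>"
proof -
  interpret S: ring S by fact
  interpret N: submodule R N M by fact
  interpret M: module R M by (rule N.module)
  show ?thesis
    using linear_formD(1,2)[OF assms(3) N.zero_closed] N.zero_closed
    by (metis M.M.l_zero M.M.zero_closed S.idem_add_zero)
qed

lemma linear_form_lincomb_zero:
  assumes "cring S" "module R M" "carrier R \<subseteq> carrier S" "linear_form R S M (carrier M) f"
    and "finite A" "A \<subseteq> carrier M" "c \<in> A \<rightarrow> carrier R" "\<And>v. v \<in> A \<Longrightarrow> f v = \<zero>\<^bsub>S\<^esub>"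
  shows "f (LinearCombinations.module.lincomb M c A) = \<zero>\<^bsub>S\<^esub>"
proof -
  interpret S: cring S by fact
  interpret M: module R M by fact
  have sub: "submodule R (carrier M) M" by unfold_locales auto
  show ?thesis using assms(5-8)
  proof (induction A rule: finite_induct)
    case empty
    then show ?case using linear_form_zero[OF S.ring_axioms sub assms(4)] by simp
  next
    case (insert x A)
    have "M.lincomb c (insert x A) = c x \<odot>\<^bsub>M\<^esub> x \<oplus>\<^bsub>M\<^esub> M.lincomb c A"
      using insert by (intro M.lincomb_insert2) auto
    moreover have "M.lincomb c A \<in> carrier M" "c x \<in> carrier R" "x \<in> carrier M"
      using insert by auto
    moreover have "c x \<in> carrier S" using insert.prems assms(3) by auto
    moreover have "f (M.lincomb c A) = \<zero>\<^bsub>S\<^esub>" "f x = \<zero>\<^bsub>S\<^esub>" using insert by auto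
    ultimately show ?case using linear_formD(2,3)[OF assms(4)] by simp
  qed
qed

lemma linear_form_lincomb_delta:
  assumes "cring S" "module R M" "carrier R \<subseteq> carrier S" "linear_form R S M (carrier M) f"
    and "finite A" "A \<subseteq> carrier M" "c \<in> A \<rightarrow> carrier R" "v \<in> A"
    and "f v = \<one>\<^bsub>S\<^esub>" "\<And>w. w \<in> A \<Longrightarrow> w \<noteq> v \<Longrightarrow> f w = \<zero>\<^bsub>S\<^esub>"
  shows "f (LinearCombinations.module.lincomb M c A) = c v"
proof -
  interpret S: cring S by fact
  interpret M: module R M by fact
  have "M.lincomb c A = c v \<odot>\<^bsub>M\<^esub> v \<oplus>\<^bsub>M\<^esub> M.lincomb c (A - {v})"
    using assms by (intro M.lincomb_del2) auto
  moreover have "M.lincomb c (A - {v}) \<in> carrier M" using assms(6,7) by (intro M.lincomb_closed) auto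
  moreover have "f (M.lincomb c (A - {v})) = \<zero>\<^bsub>S\<^esub>"
    using assms by (intro linear_form_lincomb_zero[OF assms(1-4)]) auto
  moreover have "c v \<in> carrier R" "v \<in> carrier M" "c v \<in> carrier S" using assms by auto
  ultimately show ?thesis using linear_formD(2,3)[OF assms(4)] assms(9) by simp
qed

text \<open>The form belonging to \<open>v\<close> reads off the coefficient of \<open>v\<close> from a linear combination, so a
  combination with value 0 has all its coefficients 0.\<close>

lemma lin_indpt_if_dual_forms:
  assumes "cring S" "module R M" "carrier R \<subseteq> carrier S" "\<zero>\<^bsub>R\<^esub> = \<zero>\<^bsub>S\<^esub>"
    and "finite A" "A \<subseteq> carrier M"
    and dual: "\<And>v. v \<in> A \<Longrightarrow> \<exists>f. linear_form R S M (carrier M) f \<and> f v = \<one>\<^bsub>S\<^esub>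
      \<and> (\<forall>w\<in>A. w \<noteq> v \<longrightarrow> f w = \<zero>\<^bsub>S\<^esub>)"
  shows "\<not> LinearCombinations.module.lin_dep R M A"
proof -
  interpret S: cring S by fact
  interpret M: module R M by fact
  have sub: "submodule R (carrier M) M" by unfold_locales auto
  show ?thesis
  proof (rule M.finite_lin_indpt2[OF assms(5,6)], intro ballI)
    fix c v
    assume c: "c \<in> A \<rightarrow> carrier R" "M.lincomb c A = \<zero>\<^bsub>M\<^esub>" and v: "v \<in> A"
    obtain f where f: "linear_form R S M (carrier M) f" "f v = \<one>\<^bsub>S\<^esub>"
        "\<forall>w\<in>A. w \<noteq> v \<longrightarrow> f w = \<zero>\<^bsub>S\<^esub>"
      using dual[OF v] by blast
    have "c v = f (M.lincomb c A)"
      using linear_form_lincomb_delta[OF assms(1-3) f(1) assms(5,6) c(1) v f(2)] f(3) by simp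
    then show "c v = \<zero>\<^bsub>R\<^esub>"
      using linear_form_zero[OF S.ring_axioms sub f(1)] c(2) assms(4) by simp
  qed
qed

section \<open>Extending linear forms\<close>

locale extension_to_field = scalar_extension_setup S R M
  for S R :: "('r, 'm) ring_scheme" and M :: "('r, 'a, 'n) module_scheme" +
  fixes K
  assumes field: "field S" and subring: "subring K S" and R_eq: "R = S\<lparr>carrier := K\<rparr>"
begin

declare E_simps [simp del]

lemma R_ops: "monoid.mult R = monoid.mult S" "one R = one S" "add R = add S" "ring.zero R = ring.zero S"
  by (simp_all add: R_eq)

text \<open>On \<open>N + R a\<close> the extension must be \<open>x + r a \<mapsto> f x + r v\<close>. This is well defined exactly if \<open>v\<close>
  agrees with \<open>f\<close> on the multiples of \<open>a\<close> that already lie in \<open>N\<close>.\<close>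

lemma extend_linear_form_by_value:
  assumes N: "submodule R N M" and f: "linear_form R S M N f"
    and a: "a \<in> carrier M" and v: "v \<in> carrier S"
    and compatible: "\<And>t. t \<in> carrier R \<Longrightarrow> t \<odot>\<^bsub>M\<^esub> a \<in> N \<Longrightarrow> f (t \<odot>\<^bsub>M\<^esub> a) = t \<otimes>\<^bsub>S\<^esub> v"
  shows "\<exists>N' g. submodule R N' M \<and> insert a N \<subseteq> N' \<and> linear_form R S M N' g
    \<and> g a = v \<and> (\<forall>x\<in>N. g x = f x)"
proof -
  interpret N: submodule R N M by fact
  note NM = subsetD[OF N.subset]
  define N' where "N' = {x \<oplus>\<^bsub>M\<^esub> r \<odot>\<^bsub>M\<^esub> a | x r. x \<in> N \<and> r \<in> carrier R}"
  define g where "g z = (SOME w. \<exists>x\<in>N. \<exists>r\<in>carrier R. z = x \<oplus>\<^bsub>M\<^esub> r \<odot>\<^bsub>M\<^esub> a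
    \<and> w = f x \<oplus>\<^bsub>S\<^esub> r \<otimes>\<^bsub>S\<^esub> v)" for z
  have uniq: "f x \<oplus>\<^bsub>S\<^esub> r \<otimes>\<^bsub>S\<^esub> v = f y \<oplus>\<^bsub>S\<^esub> s \<otimes>\<^bsub>S\<^esub> v"
    if x: "x \<in> N" "y \<in> N" and r: "r \<in> carrier R" "s \<in> carrier R"
      and eq: "x \<oplus>\<^bsub>M\<^esub> r \<odot>\<^bsub>M\<^esub> a = y \<oplus>\<^bsub>M\<^esub> s \<odot>\<^bsub>M\<^esub> a" for x y r s
  proof -
    \<comment> \<open>Two representations differ by the multiple \<open>(r - s) a = y - x\<close> of \<open>a\<close>, which lies in \<open>N\<close>.\<close>
    define t where "t = r \<ominus>\<^bsub>R\<^esub> s"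
    have t: "t \<in> carrier R" using r unfolding t_def by simp
    have rt: "r = t \<oplus>\<^bsub>R\<^esub> s"
      using r unfolding t_def by (simp add: M.R.minus_eq M.R.a_assoc M.R.l_neg)
    have "x \<oplus>\<^bsub>M\<^esub> t \<odot>\<^bsub>M\<^esub> a \<oplus>\<^bsub>M\<^esub> s \<odot>\<^bsub>M\<^esub> a = y \<oplus>\<^bsub>M\<^esub> s \<odot>\<^bsub>M\<^esub> a"
      using eq r t a x NM by (simp add: rt M.smult_l_distr M.M.a_assoc)
    then have y: "y = x \<oplus>\<^bsub>M\<^esub> t \<odot>\<^bsub>M\<^esub> a"
      using r t a x NM by (simp add: M.M.add.right_cancel)
    have "t \<odot>\<^bsub>M\<^esub> a = (\<ominus>\<^bsub>R\<^esub> \<one>\<^bsub>R\<^esub>) \<odot>\<^bsub>M\<^esub> x \<oplus>\<^bsub>M\<^esub> y"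
      using t a x NM by (simp add: y M.smult_minus_1 M.M.r_neg1)
    also have "\<dots> \<in> N" using x by simp
    finally have "t \<odot>\<^bsub>M\<^esub> a \<in> N" .
    then have "f y = f x \<oplus>\<^bsub>S\<^esub> t \<otimes>\<^bsub>S\<^esub> v"
      using y linear_formD(2)[OF f x(1)] compatible[OF t] by simp
    moreover have "r \<otimes>\<^bsub>S\<^esub> v = t \<otimes>\<^bsub>S\<^esub> v \<oplus>\<^bsub>S\<^esub> s \<otimes>\<^bsub>S\<^esub> v"
      using R_in_S t r v by (simp add: rt R_ops S.l_distr)
    ultimately show ?thesis
      using linear_formD(1)[OF f x(1)] R_in_S t r v by (simp add: S.a_assoc)
  qed
  have g: "g (x \<oplus>\<^bsub>M\<^esub> r \<odot>\<^bsub>M\<^esub> a) = f x \<oplus>\<^bsub>S\<^esub> r \<otimes>\<^bsub>S\<^esub> v"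
    if "x \<in> N" "r \<in> carrier R" for x r
    unfolding g_def
  proof (rule some_equality)
    fix w
    assume "\<exists>y\<in>N. \<exists>s\<in>carrier R. x \<oplus>\<^bsub>M\<^esub> r \<odot>\<^bsub>M\<^esub> a = y \<oplus>\<^bsub>M\<^esub> s \<odot>\<^bsub>M\<^esub> a
      \<and> w = f y \<oplus>\<^bsub>S\<^esub> s \<otimes>\<^bsub>S\<^esub> v"
    then show "w = f x \<oplus>\<^bsub>S\<^esub> r \<otimes>\<^bsub>S\<^esub> v"
      by (elim bexE conjE) (simp only: uniq[OF that(1) _ that(2)])
  qed (intro bexI[of _ x] bexI[of _ r] conjI refl that)
  have f0: "f \<zero>\<^bsub>M\<^esub> = \<zero>\<^bsub>S\<^esub>" by (rule linear_form_zero[OF S.ring_axioms N f])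
  have N'I: "x \<oplus>\<^bsub>M\<^esub> r \<odot>\<^bsub>M\<^esub> a \<in> N'" if "x \<in> N" "r \<in> carrier R" for x r
    using that unfolding N'_def by blast
  have add: "(x \<oplus>\<^bsub>M\<^esub> r \<odot>\<^bsub>M\<^esub> a) \<oplus>\<^bsub>M\<^esub> (y \<oplus>\<^bsub>M\<^esub> s \<odot>\<^bsub>M\<^esub> a) = (x \<oplus>\<^bsub>M\<^esub> y) \<oplus>\<^bsub>M\<^esub> (r \<oplus>\<^bsub>R\<^esub> s) \<odot>\<^bsub>M\<^esub> a"
    if "x \<in> N" "y \<in> N" "r \<in> carrier R" "s \<in> carrier R" for x y r s
    using that a NM by (simp add: M.smult_l_distr M.M.a_ac)
  have smult: "t \<odot>\<^bsub>M\<^esub> (x \<oplus>\<^bsub>M\<^esub> r \<odot>\<^bsub>M\<^esub> a) = t \<odot>\<^bsub>M\<^esub> x \<oplus>\<^bsub>M\<^esub> (t \<otimes>\<^bsub>R\<^esub> r) \<odot>\<^bsub>M\<^esub> a"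
    if "x \<in> N" "r \<in> carrier R" "t \<in> carrier R" for x r t
    using that a NM by (simp add: M.smult_r_distr M.smult_assoc1)
  have x_eq: "x = x \<oplus>\<^bsub>M\<^esub> \<zero>\<^bsub>R\<^esub> \<odot>\<^bsub>M\<^esub> a" if "x \<in> N" for x
    using that a NM by (simp add: M.lmult_0)
  have a_eq: "a = \<zero>\<^bsub>M\<^esub> \<oplus>\<^bsub>M\<^esub> \<one>\<^bsub>R\<^esub> \<odot>\<^bsub>M\<^esub> a" using a by simp
  have sub: "submodule R N' M"
  proof (rule submodule.intro[OF M.module_axioms])
    show "N' \<subseteq> carrier M" unfolding N'_def using a NM by auto
    show "\<zero>\<^bsub>M\<^esub> \<in> N'" using N'I[OF N.zero_closed M.R.zero_closed] x_eq[OF N.zero_closed] by simp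
    fix z assume "z \<in> N'"
    then obtain x r where z: "x \<in> N" "r \<in> carrier R" "z = x \<oplus>\<^bsub>M\<^esub> r \<odot>\<^bsub>M\<^esub> a" unfolding N'_def by blast
    show "t \<odot>\<^bsub>M\<^esub> z \<in> N'" if t: "t \<in> carrier R" for t
      unfolding z(3) smult[OF z(1,2) t] using z t by (intro N'I) auto
    fix w assume "w \<in> N'"
    then obtain y s where w: "y \<in> N" "s \<in> carrier R" "w = y \<oplus>\<^bsub>M\<^esub> s \<odot>\<^bsub>M\<^esub> a" unfolding N'_def by blast
    show "z \<oplus>\<^bsub>M\<^esub> w \<in> N'"
      unfolding z(3) w(3) add[OF z(1) w(1) z(2) w(2)] using z w by (intro N'I) auto
  qed
  have form: "linear_form R S M N' g"
    unfolding linear_form_def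
  proof (intro conjI ballI funcsetI)
    fix z assume "z \<in> N'"
    then obtain x r where z: "x \<in> N" "r \<in> carrier R" "z = x \<oplus>\<^bsub>M\<^esub> r \<odot>\<^bsub>M\<^esub> a" unfolding N'_def by blast
    then show "g z \<in> carrier S" using g R_in_S v linear_formD(1)[OF f] by simp
    show "g (t \<odot>\<^bsub>M\<^esub> z) = t \<otimes>\<^bsub>S\<^esub> g z" if t: "t \<in> carrier R" for t
    proof -
      have "g (t \<odot>\<^bsub>M\<^esub> z) = f (t \<odot>\<^bsub>M\<^esub> x) \<oplus>\<^bsub>S\<^esub> (t \<otimes>\<^bsub>R\<^esub> r) \<otimes>\<^bsub>S\<^esub> v"
        unfolding z(3) smult[OF z(1,2) t] using z t by (intro g) auto
      also have "\<dots> = t \<otimes>\<^bsub>S\<^esub> g z"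
        using z t v R_in_S linear_formD(1)[OF f z(1)]
        by (simp add: g linear_formD(3)[OF f] R_ops S.r_distr S.m_assoc)
      finally show ?thesis .
    qed
    fix w assume "w \<in> N'"
    then obtain y s where w: "y \<in> N" "s \<in> carrier R" "w = y \<oplus>\<^bsub>M\<^esub> s \<odot>\<^bsub>M\<^esub> a" unfolding N'_def by blast
    have "g (z \<oplus>\<^bsub>M\<^esub> w) = f (x \<oplus>\<^bsub>M\<^esub> y) \<oplus>\<^bsub>S\<^esub> (r \<oplus>\<^bsub>R\<^esub> s) \<otimes>\<^bsub>S\<^esub> v"
      unfolding z(3) w(3) add[OF z(1) w(1) z(2) w(2)] using z w by (intro g) auto
    also have "\<dots> = g z \<oplus>\<^bsub>S\<^esub> g w"
      using z w v R_in_S linear_formD(1)[OF f]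
      by (simp add: g linear_formD(2)[OF f] R_ops S.l_distr S.a_ac)
    finally show "g (z \<oplus>\<^bsub>M\<^esub> w) = g z \<oplus>\<^bsub>S\<^esub> g w" .
  qed
  have gf: "g x = f x" if "x \<in> N" for x
    using g[OF that M.R.zero_closed] x_eq[OF that] linear_formD(1)[OF f that] v by (simp add: R_ops)
  have ga: "g a = v"
    using g[OF N.zero_closed M.R.one_closed] a_eq f0 v by (simp add: R_ops)
  have "insert a N \<subseteq> N'"
    using N'I[OF N.zero_closed M.R.one_closed] N'I[OF _ M.R.zero_closed] x_eq a_eq by auto
  then show ?thesis using sub form gf ga by (intro exI[of _ N'] exI[of _ g] conjI ballI)
qed

text \<open>If \<open>r a \<in> N\<close> for some \<open>r \<noteq> 0\<close>, the value at \<open>a\<close> is forced to be \<open>f (r a) / r\<close>, a quotient that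
  exists in the field \<open>S\<close>; otherwise \<open>N\<close> and \<open>R a\<close> are independent and any value will do.\<close>

lemma extend_linear_form_step:
  assumes N: "submodule R N M" and f: "linear_form R S M N f" and a: "a \<in> carrier M"
  shows "\<exists>N' g. submodule R N' M \<and> insert a N \<subseteq> N' \<and> linear_form R S M N' g \<and> (\<forall>x\<in>N. g x = f x)"
proof -
  interpret N: submodule R N M by fact
  interpret S: field S by (rule field)
  have "\<exists>v\<in>carrier S. \<forall>t\<in>carrier R. t \<odot>\<^bsub>M\<^esub> a \<in> N \<longrightarrow> f (t \<odot>\<^bsub>M\<^esub> a) = t \<otimes>\<^bsub>S\<^esub> v"
  proof (cases "\<exists>r\<in>carrier R. r \<noteq> \<zero>\<^bsub>S\<^esub> \<and> r \<odot>\<^bsub>M\<^esub> a \<in> N")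
    case True
    then obtain r where r: "r \<in> carrier R" "r \<noteq> \<zero>\<^bsub>S\<^esub>" "r \<odot>\<^bsub>M\<^esub> a \<in> N" by blast
    have u: "r \<in> Units S" using r R_in_S by (simp add: S.field_Units)
    have fr: "f (r \<odot>\<^bsub>M\<^esub> a) \<in> carrier S" using linear_formD(1)[OF f r(3)] .
    show ?thesis
    proof (intro bexI ballI impI)
      show v: "inv\<^bsub>S\<^esub> r \<otimes>\<^bsub>S\<^esub> f (r \<odot>\<^bsub>M\<^esub> a) \<in> carrier S" using u fr by simp
      fix t assume t: "t \<in> carrier R" "t \<odot>\<^bsub>M\<^esub> a \<in> N"
      have ft: "f (t \<odot>\<^bsub>M\<^esub> a) \<in> carrier S" using linear_formD(1)[OF f t(2)] .
      \<comment> \<open>The quotient does not depend on \<open>r\<close>: compare both sides of \<open>f (r t a) = f (t r a)\<close>.\<close>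
      have "r \<odot>\<^bsub>M\<^esub> (t \<odot>\<^bsub>M\<^esub> a) = t \<odot>\<^bsub>M\<^esub> (r \<odot>\<^bsub>M\<^esub> a)"
        using r t a by (simp add: M.R.m_comm flip: M.smult_assoc1)
      then have "r \<otimes>\<^bsub>S\<^esub> f (t \<odot>\<^bsub>M\<^esub> a) = t \<otimes>\<^bsub>S\<^esub> f (r \<odot>\<^bsub>M\<^esub> a)"
        using linear_formD(3)[OF f] r t by metis
      then have "inv\<^bsub>S\<^esub> r \<otimes>\<^bsub>S\<^esub> (r \<otimes>\<^bsub>S\<^esub> f (t \<odot>\<^bsub>M\<^esub> a)) = t \<otimes>\<^bsub>S\<^esub> (inv\<^bsub>S\<^esub> r \<otimes>\<^bsub>S\<^esub> f (r \<odot>\<^bsub>M\<^esub> a))"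
        using u fr R_in_S[OF t(1)] by (simp add: S.m_lcomm)
      then show "f (t \<odot>\<^bsub>M\<^esub> a) = t \<otimes>\<^bsub>S\<^esub> (inv\<^bsub>S\<^esub> r \<otimes>\<^bsub>S\<^esub> f (r \<odot>\<^bsub>M\<^esub> a))"
        using u ft R_in_S[OF r(1)] by (simp flip: S.m_assoc)
    qed
  next
    case False
    then show ?thesis
      using a linear_form_zero[OF S.ring_axioms N f]
      by (intro bexI[of _ "\<zero>\<^bsub>S\<^esub>"]) (auto simp: M.lmult_0[unfolded R_ops])
  qed
  then obtain v where v: "v \<in> carrier S"
      "\<forall>t\<in>carrier R. t \<odot>\<^bsub>M\<^esub> a \<in> N \<longrightarrow> f (t \<odot>\<^bsub>M\<^esub> a) = t \<otimes>\<^bsub>S\<^esub> v" ..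
  show ?thesis
    using extend_linear_form_by_value[OF N f a v(1)] v(2) by metis
qed

lemma extend_linear_form:
  assumes N: "submodule R N M" and f: "linear_form R S M N f"
    and A: "finite A" "A \<subseteq> carrier M" "M.span A = carrier M"
  shows "\<exists>g. linear_form R S M (carrier M) g \<and> (\<forall>x\<in>N. g x = f x)"
proof -
  have "\<exists>N' g. submodule R N' M \<and> A \<union> N \<subseteq> N' \<and> linear_form R S M N' g \<and> (\<forall>x\<in>N. g x = f x)"
    using A(1,2)
  proof (induction A rule: finite_induct)
    case empty
    show ?case using N f by (intro exI[of _ N] exI[of _ f]) simp
  next
    case (insert a A)
    then obtain N' g where g: "submodule R N' M" "A \<union> N \<subseteq> N'" "linear_form R S M N' g"
        "\<forall>x\<in>N. g x = f x" by blast
    obtain N'' h where h: "submodule R N'' M" "insert a N' \<subseteq> N''" "linear_form R S M N'' h"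
        "\<forall>x\<in>N'. h x = g x"
      using extend_linear_form_step[OF g(1,3)] insert.prems by blast
    have "insert a A \<union> N \<subseteq> N''" "\<forall>x\<in>N. h x = f x" using g(2,4) h(2,4) by auto
    then show ?case using h(1,3) by (intro exI[of _ N''] exI[of _ h] conjI)
  qed
  then obtain N' g where g: "submodule R N' M" "A \<union> N \<subseteq> N'" "linear_form R S M N' g"
      "\<forall>x\<in>N. g x = f x" by blast
  have "carrier M \<subseteq> N'" using M.span_is_subset[of A N'] g(1,2) A(3) by blast
  then have N': "N' = carrier M" using submodule.subset[OF g(1)] by auto
  show ?thesis using g(3,4) unfolding N' by (intro exI[of _ g] conjI)
qed

lemma multiple_in_span_of_others:
  assumes B: "finite B" "B \<subseteq> carrier M" "\<not> M.lin_dep B" and s: "s \<in> B"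
    and t: "t \<in> carrier R" "t \<odot>\<^bsub>M\<^esub> s \<in> M.span (B - {s})"
  shows "t = \<zero>\<^bsub>R\<^esub>"
proof (rule ccontr)
  assume "t \<noteq> \<zero>\<^bsub>R\<^esub>"
  have B': "finite (B - {s})" "B - {s} \<subseteq> carrier M" using B by auto
  obtain c where c: "c \<in> B - {s} \<rightarrow> carrier R" "M.lincomb c (B - {s}) = t \<odot>\<^bsub>M\<^esub> s"
    using M.finite_in_span[OF B' t(2)] by blast
  define d where "d = (\<lambda>w. (\<ominus>\<^bsub>R\<^esub> \<one>\<^bsub>R\<^esub>) \<otimes>\<^bsub>R\<^esub> c w)(s := t)"
  have d: "d \<in> B \<rightarrow> carrier R" using c(1) t(1) unfolding d_def by (auto intro!: M.R.m_closed)
  have sM: "s \<in> carrier M" using s B by auto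
  have "M.lincomb d (B - {s}) = M.lincomb (\<lambda>w. (\<ominus>\<^bsub>R\<^esub> \<one>\<^bsub>R\<^esub>) \<otimes>\<^bsub>R\<^esub> c w) (B - {s})"
    using c(1) by (intro M.lincomb_cong B') (auto simp: d_def)
  also have "\<dots> = (\<ominus>\<^bsub>R\<^esub> \<one>\<^bsub>R\<^esub>) \<odot>\<^bsub>M\<^esub> (t \<odot>\<^bsub>M\<^esub> s)"
    using M.lincomb_smult[OF B'(2) c(1)] c(2) by simp
  also have "\<dots> = \<ominus>\<^bsub>M\<^esub> (t \<odot>\<^bsub>M\<^esub> s)" using t sM by (simp add: M.smult_minus_1)
  finally have "M.lincomb d B = \<zero>\<^bsub>M\<^esub>"
    using M.lincomb_del2[OF B(1,2) d s] t sM by (simp add: d_def M.M.r_neg)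
  then have "M.lin_dep B"
    using \<open>t \<noteq> \<zero>\<^bsub>R\<^esub>\<close> by (intro M.lin_dep_crit[OF B(1) subset_refl d s]) (auto simp: d_def)
  then show False using B by simp
qed

text \<open>Start from the zero form on the span of \<open>B - {s}\<close>. No nonzero multiple of \<open>s\<close> lies in that span,
  so the value at \<open>s\<close> may be chosen to be 1; then extend to the whole module.\<close>

lemma dual_form_exists:
  assumes B: "finite B" "B \<subseteq> carrier M" "\<not> M.lin_dep B" and s: "s \<in> B"
    and A: "finite A" "A \<subseteq> carrier M" "M.span A = carrier M"
  shows "\<exists>f. linear_form R S M (carrier M) f \<and> f s = \<one>\<^bsub>S\<^esub> \<and> (\<forall>t\<in>B. t \<noteq> s \<longrightarrow> f t = \<zero>\<^bsub>S\<^esub>)"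
proof -
  let ?N = "M.span (B - {s})"
  have N: "submodule R ?N M" using B by (intro M.span_is_submodule) auto
  have form: "linear_form R S M ?N (\<lambda>_. \<zero>\<^bsub>S\<^esub>)"
    using R_in_S unfolding linear_form_def by auto
  have sM: "s \<in> carrier M" using s B by auto
  have "\<zero>\<^bsub>S\<^esub> = t \<otimes>\<^bsub>S\<^esub> \<one>\<^bsub>S\<^esub>" if "t \<in> carrier R" "t \<odot>\<^bsub>M\<^esub> s \<in> ?N" for t
    using multiple_in_span_of_others[OF B s that] by (simp add: R_ops)
  then obtain N' g where g: "submodule R N' M" "insert s ?N \<subseteq> N'" "linear_form R S M N' g"
      "g s = \<one>\<^bsub>S\<^esub>" "\<forall>x\<in>?N. g x = \<zero>\<^bsub>S\<^esub>"
    using extend_linear_form_by_value[OF N form sM S.one_closed] by auto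
  obtain h where h: "linear_form R S M (carrier M) h" "\<forall>x\<in>N'. h x = g x"
    using extend_linear_form[OF g(1,3) A] by blast
  have "B - {s} \<subseteq> ?N" using B by (intro M.in_own_span) auto
  then have "\<forall>t\<in>B. t \<noteq> s \<longrightarrow> h t = \<zero>\<^bsub>S\<^esub>" using h(2) g(2,5) by (metis Diff_iff insert_iff empty_iff subsetD)
  moreover have "h s = \<one>\<^bsub>S\<^esub>" using h(2) g(2,4) by simp
  ultimately show ?thesis using h(1) by (intro exI[of _ h] conjI)
qed

end


section \<open>Linear independence in the scalar extension\<close>

context scalar_extension_setup
begin

text \<open>The universal property of the tensor product, for maps to \<open>S\<close>: \<open>(a, x) \<mapsto> a (f x)\<close> extends to the
  free abelian group, and its extension vanishes on the relators.\<close>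

lemma linear_form_on_scalar_extension:
  assumes f: "linear_form R S M (carrier M) f"
  obtains g where "linear_form S S E (carrier E) g"
    "\<And>a x. a \<in> carrier S \<Longrightarrow> x \<in> carrier M \<Longrightarrow> g (pure_tensor R S M a x) = a \<otimes>\<^bsub>S\<^esub> f x"
proof -
  note [simp del] = carrier_free_Abelian_group_iff E_simps
  note fD = linear_formD[OF f]
  have "(\<lambda>(a, x). a \<otimes>\<^bsub>S\<^esub> f x) ` (carrier S \<times> carrier M) \<subseteq> carrier (add_monoid S)"
    using fD(1) by auto
  then obtain h where h: "h \<in> hom F (add_monoid S)"
    and h_frag': "\<And>p. p \<in> carrier S \<times> carrier M \<Longrightarrow> h (frag_of p) = (\<lambda>(a, x). a \<otimes>\<^bsub>S\<^esub> f x) p"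
    by (rule comm_group.free_Abelian_group_universal[OF S.a_comm_group]) blast
  interpret h: group_hom F "add_monoid S" h by unfold_locales (rule h)
  have h_frag: "h (frag_of (a, x)) = a \<otimes>\<^bsub>S\<^esub> f x" if "a \<in> carrier S" "x \<in> carrier M" for a x
    using h_frag'[of "(a, x)"] that by simp
  have h_closed: "h c \<in> carrier S" if "c \<in> carrier F" for c
    using h.hom_closed[OF that] by simp
  have h_add: "h (c + d) = h c \<oplus>\<^bsub>S\<^esub> h d" if "c \<in> carrier F" "d \<in> carrier F" for c d
    using h.hom_mult[OF that] by simp
  have diff_closed: "c - d \<in> carrier F" if "c \<in> carrier F" "d \<in> carrier F" for c d
    using that keys_diff[of c d] unfolding carrier_free_Abelian_group_iff by auto
  have h_diff: "h (c - d) = h c \<ominus>\<^bsub>S\<^esub> h d" if "c \<in> carrier F" "d \<in> carrier F" for c d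
  proof -
    have "h c = h (c - d) \<oplus>\<^bsub>S\<^esub> h d" using h_add[OF diff_closed[OF that] that(2)] by simp
    then show ?thesis
      using h_closed[OF diff_closed[OF that]] h_closed[OF that(2)]
      by (simp add: S.minus_eq S.a_assoc S.r_neg)
  qed
  have "T \<subseteq> kernel F (add_monoid S) h"
    unfolding tensor_null_def
  proof (rule F.generate_subgroup_incl[OF subsetI h.subgroup_kernel])
    fix t assume t: "t \<in> tensor_relators R S M"
    from t have "h t = \<zero>\<^bsub>S\<^esub>"
    proof (cases rule: tensor_relatorsE)
      case (left a b x)
      then show ?thesis
        by (simp add: h_diff h_add h_frag add_carrier frag_carrier S.l_distr S.r_neg S.minus_eq fD)
    next
      case (right a x y)
      then show ?thesis
        by (simp add: h_diff h_add h_frag add_carrier frag_carrier S.r_distr S.r_neg S.minus_eq fD)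
    next
      case (balanced a r x)
      then show ?thesis
        by (simp add: h_diff h_frag frag_carrier R_in_S S.m_assoc S.r_neg S.minus_eq fD)
    qed
    then show "t \<in> kernel F (add_monoid S) h"
      using t relators_carrier unfolding kernel_def by auto
  qed
  then have h_T: "h c = \<zero>\<^bsub>S\<^esub>" if "c \<in> T" for c
    using that unfolding kernel_def by auto
  have h_act: "h (act a c) = a \<otimes>\<^bsub>S\<^esub> h c" if a: "a \<in> carrier S" and c: "c \<in> carrier F" for a c
  proof -
    have "Poly_Mapping.keys c \<subseteq> carrier S \<times> carrier M"
      using c unfolding carrier_free_Abelian_group_iff .
    then have "c \<in> carrier F \<and> h (act a c) = a \<otimes>\<^bsub>S\<^esub> h c"
    proof (induction c rule: frag_induction)
      case zero
      then show ?case using h.hom_one F.one_closed a by simp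
    next
      case (one p)
      then show ?case using a by (cases p) (simp add: h_frag frag_carrier S.m_assoc fD)
    next
      case (diff c d)
      then show ?case
        using a by (simp add: frag_extend_diff h_diff diff_closed act_closed h_closed
            S.minus_eq S.r_distr S.r_minus)
    qed
    then show ?thesis ..
  qed
  \<comment> \<open>Representatives of the same coset differ by an element of \<open>T\<close>, where \<open>h\<close> vanishes.\<close>
  define g where "g C = h (SOME c. c \<in> carrier F \<and> C = cl c)" for C
  have g_cl: "g (cl c) = h c" if c: "c \<in> carrier F" for c
  proof -
    define d where "d = (SOME d. d \<in> carrier F \<and> cl c = cl d)"
    have d: "d \<in> carrier F" "cl c = cl d"
      using someI[of "\<lambda>d. d \<in> carrier F \<and> cl c = cl d" c] c unfolding d_def by auto
    have "d \<in> cl c" using F.rcos_self[OF d(1) T_subgroup] d(2) by simp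
    then have "h (d - c) = \<zero>\<^bsub>S\<^esub>" by (simp add: frag_coset_iff h_T)
    then have "h d = h c"
      using h_diff[OF d(1) c] h_closed[OF d(1)] h_closed[OF c] by simp
    then show ?thesis by (simp add: g_def d_def)
  qed
  have "linear_form S S E (carrier E) g"
    unfolding linear_form_def
  proof (intro conjI ballI funcsetI)
    fix C assume "C \<in> carrier E"
    then obtain c where c: "c \<in> carrier F" "C = cl c" by (rule E_cases)
    show "g C \<in> carrier S" unfolding c(2) g_cl[OF c(1)] by (rule h_closed[OF c(1)])
    show "g (a \<odot>\<^bsub>E\<^esub> C) = a \<otimes>\<^bsub>S\<^esub> g C" if a: "a \<in> carrier S" for a
      unfolding c(2) smult_cl[OF a c(1)] g_cl[OF c(1)] g_cl[OF act_closed[OF a c(1)]]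
      by (rule h_act[OF a c(1)])
    fix D assume "D \<in> carrier E"
    then obtain d where d: "d \<in> carrier F" "D = cl d" by (rule E_cases)
    show "g (C \<oplus>\<^bsub>E\<^esub> D) = g C \<oplus>\<^bsub>S\<^esub> g D"
      unfolding c(2) d(2) cl_add[OF c(1) d(1)] g_cl[OF c(1)] g_cl[OF d(1)]
        g_cl[OF add_carrier[OF c(1) d(1)]]
      by (rule h_add[OF c(1) d(1)])
  qed
  moreover have "g (pure_tensor R S M a x) = a \<otimes>\<^bsub>S\<^esub> f x"
    if "a \<in> carrier S" "x \<in> carrier M" for a x
    unfolding pure_tensor_eq g_cl[OF frag_carrier[OF that]] by (rule h_frag[OF that])
  ultimately show thesis by (rule that)
qed

lemma pure_tensor_zero_right:
  assumes "a \<in> carrier S"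
  shows "pure_tensor R S M a \<zero>\<^bsub>M\<^esub> = \<zero>\<^bsub>E\<^esub>"
proof -
  note [simp del] = E_simps
  interpret E: module S E by (rule scalar_extension_module)
  show ?thesis
    using pure_tensor_add_right[OF assms M.M.zero_closed M.M.zero_closed]
      pure_tensor_closed[OF assms M.M.zero_closed]
    by (metis E.M.add.l_cancel_one M.M.l_zero M.M.zero_closed)
qed

text \<open>The vectors \<open>x\<close> of \<open>M\<close> for which \<open>1 \<otimes> x\<close> lies in the span form a submodule, so they are all of \<open>M\<close>
  once they include the generators; and every \<open>a \<otimes> x\<close> is the multiple \<open>a (1 \<otimes> x)\<close>.\<close>

lemma span_pure_tensors:
  assumes A: "A \<subseteq> carrier M" "M.span A = carrier M"
  shows "LinearCombinations.module.span S E (pure_tensor R S M \<one>\<^bsub>S\<^esub> ` A) = carrier E"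
proof
  note [simp del] = carrier_free_Abelian_group_iff E_simps
  interpret E: module S E by (rule scalar_extension_module)
  let ?\<iota> = "pure_tensor R S M \<one>\<^bsub>S\<^esub>"
  let ?W = "E.span (?\<iota> ` A)"
  have \<iota>A: "?\<iota> ` A \<subseteq> carrier E" using A pure_tensor_closed by auto
  show "?W \<subseteq> carrier E" by (rule E.span_is_subset2[OF \<iota>A])
  interpret W: submodule S ?W E by (rule E.span_is_submodule[OF \<iota>A])
  have "submodule R {x \<in> carrier M. ?\<iota> x \<in> ?W} M"
  proof (rule submodule.intro[OF M.module_axioms])
    fix r x assume "r \<in> carrier R" "x \<in> {x \<in> carrier M. ?\<iota> x \<in> ?W}"
    then show "r \<odot>\<^bsub>M\<^esub> x \<in> {x \<in> carrier M. ?\<iota> x \<in> ?W}"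
      using smult_pure_tensor[of r "\<one>\<^bsub>S\<^esub>" x] pure_tensor_balanced[of "\<one>\<^bsub>S\<^esub>" r x] R_in_S
        W.smult_closed[of r "?\<iota> x"]
      by simp
  qed (auto simp: pure_tensor_add_right pure_tensor_zero_right)
  moreover have "A \<subseteq> {x \<in> carrier M. ?\<iota> x \<in> ?W}"
    using A(1) E.in_own_span[OF \<iota>A] by auto
  ultimately have "M.span A \<subseteq> {x \<in> carrier M. ?\<iota> x \<in> ?W}"
    by (intro M.span_is_subset)
  then have \<iota>: "?\<iota> x \<in> ?W" if "x \<in> carrier M" for x using that A(2) by auto
  show "carrier E \<subseteq> ?W"
  proof
    fix C assume "C \<in> carrier E"
    then obtain c where c: "c \<in> carrier F" "C = cl c" by (rule E_cases)
    have "Poly_Mapping.keys c \<subseteq> carrier S \<times> carrier M"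
      using c unfolding carrier_free_Abelian_group_iff by simp
    then have "c \<in> carrier F \<and> cl c \<in> ?W"
    proof (induction c rule: frag_induction)
      case zero
      have "cl 0 = \<zero>\<^bsub>E\<^esub>" by (auto simp: frag_coset_iff E_simps)
      then show ?case using F.one_closed by simp
    next
      case (one p)
      then obtain a x where p: "p = (a, x)" "a \<in> carrier S" "x \<in> carrier M" by (cases p) auto
      have "cl (frag_of p) = a \<odot>\<^bsub>E\<^esub> ?\<iota> x"
        using p smult_pure_tensor[OF p(2) S.one_closed p(3)] by (simp add: pure_tensor_eq)
      then show ?case using p \<iota> by (simp add: frag_carrier)
    next
      case (diff c d)
      have cd: "c - d \<in> carrier F"
        using diff keys_diff[of c d] unfolding carrier_free_Abelian_group_iff by auto
      have cl: "cl c = cl d \<oplus>\<^bsub>E\<^esub> cl (c - d)" using cl_add[OF _ cd, of d] diff by simp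
      have "cl (c - d) = (\<ominus>\<^bsub>S\<^esub> \<one>\<^bsub>S\<^esub>) \<odot>\<^bsub>E\<^esub> cl d \<oplus>\<^bsub>E\<^esub> cl c"
        using cl_closed[OF cd] cl_closed[of d] diff
        by (simp add: cl E.smult_minus_1 E.M.r_neg1)
      also have "\<dots> \<in> ?W" using diff by (intro W.m_closed W.smult_closed) auto
      finally show ?case using cd by simp
    qed
    then show "C \<in> ?W" using c by simp
  qed
qed

end

context extension_to_field
begin

text \<open>This is where flatness enters. The forms dual to \<open>B\<close> induce forms dual to the image
  of \<open>B\<close>; a form taking the values 1 and 0 at \<open>1 \<otimes> s\<close> and \<open>1 \<otimes> t\<close> also shows that these two tensors
  are different.\<close>

theorem pure_tensors_lin_indpt:
  assumes A: "finite A" "A \<subseteq> carrier M" "M.span A = carrier M"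
    and B: "finite B" "B \<subseteq> carrier M" "\<not> M.lin_dep B"
  shows "inj_on (pure_tensor R S M \<one>\<^bsub>S\<^esub>) B"
    and "\<not> LinearCombinations.module.lin_dep S E (pure_tensor R S M \<one>\<^bsub>S\<^esub> ` B)"
proof -
  interpret S: field S by (rule field)
  let ?\<iota> = "pure_tensor R S M \<one>\<^bsub>S\<^esub>"
  have dual: "\<exists>g. linear_form S S E (carrier E) g \<and> g (?\<iota> s) = \<one>\<^bsub>S\<^esub>
      \<and> (\<forall>t\<in>B. t \<noteq> s \<longrightarrow> g (?\<iota> t) = \<zero>\<^bsub>S\<^esub>)" if s: "s \<in> B" for s
  proof -
    obtain f where f: "linear_form R S M (carrier M) f" "f s = \<one>\<^bsub>S\<^esub>"
        "\<forall>t\<in>B. t \<noteq> s \<longrightarrow> f t = \<zero>\<^bsub>S\<^esub>"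
      using dual_form_exists[OF B s A] by (elim exE conjE)
    obtain g where g: "linear_form S S E (carrier E) g"
        "\<And>a x. a \<in> carrier S \<Longrightarrow> x \<in> carrier M \<Longrightarrow> g (pure_tensor R S M a x) = a \<otimes>\<^bsub>S\<^esub> f x"
      using linear_form_on_scalar_extension[OF f(1)] by metis
    have "g (?\<iota> t) = f t" if "t \<in> B" for t
      using g(2)[of "\<one>\<^bsub>S\<^esub>" t] linear_formD(1)[OF f(1), of t] that B(2) by auto
    then show ?thesis using f(2,3) g(1) s by (intro exI[of _ g]) simp
  qed
  show inj: "inj_on ?\<iota> B"
  proof (rule inj_onI, rule ccontr)
    fix s t assume st: "s \<in> B" "t \<in> B" "?\<iota> s = ?\<iota> t" "s \<noteq> t"
    then show False using dual[OF st(1)] S.one_not_zero by metis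
  qed
  show "\<not> LinearCombinations.module.lin_dep S E (?\<iota> ` B)"
  proof (rule lin_indpt_if_dual_forms[OF S.cring_axioms scalar_extension_module subset_refl refl])
    show "finite (?\<iota> ` B)" using B by simp
    show "?\<iota> ` B \<subseteq> carrier E" using B pure_tensor_closed by auto
    fix v assume "v \<in> ?\<iota> ` B"
    then obtain s where s: "s \<in> B" "v = ?\<iota> s" by auto
    obtain g where g: "linear_form S S E (carrier E) g" "g (?\<iota> s) = \<one>\<^bsub>S\<^esub>"
        "\<forall>t\<in>B. t \<noteq> s \<longrightarrow> g (?\<iota> t) = \<zero>\<^bsub>S\<^esub>"
      using dual[OF s(1)] by (elim exE conjE)
    show "\<exists>f. linear_form S S E (carrier E) f \<and> f v = \<one>\<^bsub>S\<^esub>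
        \<and> (\<forall>w\<in>?\<iota> ` B. w \<noteq> v \<longrightarrow> f w = \<zero>\<^bsub>S\<^esub>)"
      using g s(2) by (intro exI[of _ g] conjI) auto
  qed
qed

text \<open>Over the field \<open>S\<close> the first bound is Steinitz's theorem for the generators \<open>1 \<otimes> a\<close> with
  \<open>a \<in> A\<close>. The second one follows by sending an independent subset of \<open>M\<close> to the
  scalar extension.\<close>

lemma lin_indpt_bounded:
  assumes A: "finite A" "A \<subseteq> carrier M" "M.span A = carrier M"
  shows "finite C \<Longrightarrow> C \<subseteq> carrier E \<Longrightarrow> \<not> LinearCombinations.module.lin_dep S E C \<Longrightarrow> card C \<le> card A"
    and "finite B \<Longrightarrow> B \<subseteq> carrier M \<Longrightarrow> \<not> M.lin_dep B \<Longrightarrow> card B \<le> card A"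
proof -
  let ?\<iota> = "pure_tensor R S M \<one>\<^bsub>S\<^esub>"
  interpret S: field S by (rule field)
  interpret E: vectorspace S E
    by (intro vectorspace.intro scalar_extension_module field)
  have gen: "E.span (?\<iota> ` A) = carrier E"
    by (intro span_pure_tensors A)
  have \<iota>: "?\<iota> ` D \<subseteq> carrier E" if "D \<subseteq> carrier M" for D
    using that pure_tensor_closed by auto
  show 1: "card C \<le> card A"
    if "finite C" "C \<subseteq> carrier E" "\<not> E.lin_dep C" for C
    using E.li_smaller_than_gen[OF that(1) finite_imageI[OF A(1)] that(2) \<iota>[OF A(2)] that(3) gen]
      card_image_le[OF A(1), of ?\<iota>] by simp
  show "card B \<le> card A" if B: "finite B" "B \<subseteq> carrier M" "\<not> M.lin_dep B"
    using 1[OF finite_imageI[OF B(1)] \<iota>[OF B(2)] pure_tensors_lin_indpt(2)[OF A B]]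
      card_image[OF pure_tensors_lin_indpt(1)[OF A B]] by simp
qed

end


section \<open>The isotropy index as a maximal number of independent vectors\<close>

text \<open>Outside of fields this is the definition of the rank, once the bound makes the maximum
  meaningful; over a field, a maximal independent set is a basis. The bound is a hypothesis
  because submodules inherit bounds on independent sets, whereas finite generation
  need not pass to submodules.\<close>

lemma module_rank_is_max_lin_indpt:
  assumes M: "module R M"
    and bound: "\<And>B. finite B \<Longrightarrow> B \<subseteq> carrier M \<Longrightarrow> \<not> LinearCombinations.module.lin_dep R M B
      \<Longrightarrow> card B \<le> n"
  shows "\<exists>B. finite B \<and> B \<subseteq> carrier M \<and> \<not> LinearCombinations.module.lin_dep R M B
      \<and> card B = module_rank R M"
    and "finite B \<Longrightarrow> B \<subseteq> carrier M \<Longrightarrow> \<not> LinearCombinations.module.lin_dep R M B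
      \<Longrightarrow> card B \<le> module_rank R M"
proof -
  interpret M: module R M by (rule M)
  have empty: "\<not> M.lin_dep {}" unfolding M.lin_dep_def by auto
  have "(\<exists>B. finite B \<and> B \<subseteq> carrier M \<and> \<not> M.lin_dep B \<and> card B = module_rank R M)
    \<and> (\<forall>B. finite B \<longrightarrow> B \<subseteq> carrier M \<longrightarrow> \<not> M.lin_dep B \<longrightarrow> card B \<le> module_rank R M)"
  proof (cases "field R")
    case True
    interpret M: vectorspace R M by (intro vectorspace.intro M True)
    have "finite B \<and> card B \<le> n" if B: "B \<subseteq> carrier M \<and> \<not> M.lin_dep B" for B
    proof (cases "finite B")
      case False
      then obtain D where D: "D \<subseteq> B" "finite D" "card D = Suc n"
        using infinite_arbitrarily_large by blast
      then show ?thesis using bound[of D] B M.subset_li_is_li[of B D] by auto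
    qed (use bound B in auto)
    then obtain B where B: "finite B" "maximal B (\<lambda>D. D \<subseteq> carrier M \<and> \<not> M.lin_dep D)"
      using maximal_exists[of "\<lambda>D. D \<subseteq> carrier M \<and> \<not> M.lin_dep D" n "{}"] empty by auto
    have basis: "M.basis B" by (rule M.max_li_is_basis[OF B(2)])
    have "M.fin_dim" using B(1) basis unfolding M.fin_dim_def M.basis_def by auto
    then show ?thesis
      using M.dim_basis[OF B(1) basis] B(1) basis True M.li_le_dim(2)
      unfolding M.basis_def module_rank_def by auto
  next
    case False
    let ?C = "{card B | B. finite B \<and> B \<subseteq> carrier M \<and> \<not> M.lin_dep B}"
    have fin: "finite ?C" using bound by (intro finite_subset[of ?C "{..n}"]) auto
    have "card {} \<in> ?C" using empty by (intro CollectI exI[of _ "{}"]) simp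
    then have "Max ?C \<in> ?C" using fin by (intro Max_in) auto
    moreover have "card B \<le> Max ?C" if "finite B" "B \<subseteq> carrier M" "\<not> M.lin_dep B" for B
      using that fin by (intro Max_ge) auto
    ultimately show ?thesis using False unfolding module_rank_def by auto
  qed
  note max = this
  show "\<exists>B. finite B \<and> B \<subseteq> carrier M \<and> \<not> M.lin_dep B \<and> card B = module_rank R M"
    using max by (rule conjunct1)
  show "card B \<le> module_rank R M" if "finite B" "B \<subseteq> carrier M" "\<not> M.lin_dep B"
    using max that by blast
qed

lemma submodule_rank_is_max_lin_indpt:
  assumes M: "module R M" and N: "submodule R N M"
    and bound: "\<And>B. finite B \<Longrightarrow> B \<subseteq> carrier M \<Longrightarrow> \<not> LinearCombinations.module.lin_dep R M B
      \<Longrightarrow> card B \<le> n"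
  shows "\<exists>B. finite B \<and> B \<subseteq> N \<and> \<not> LinearCombinations.module.lin_dep R M B
      \<and> card B = module_rank R (M\<lparr>carrier := N\<rparr>)"
    and "finite B \<Longrightarrow> B \<subseteq> N \<Longrightarrow> \<not> LinearCombinations.module.lin_dep R M B
      \<Longrightarrow> card B \<le> module_rank R (M\<lparr>carrier := N\<rparr>)"
proof -
  interpret M: module R M by (rule M)
  have N': "module R (M\<lparr>carrier := N\<rparr>)" by (rule M.submodule_is_module[OF N])
  have eq: "LinearCombinations.module.lin_dep R (M\<lparr>carrier := N\<rparr>) B = M.lin_dep B" if "B \<subseteq> N" for B
    by (rule M.span_li_not_depend(2)[OF that N])
  have "card B \<le> n" if "finite B" "B \<subseteq> carrier (M\<lparr>carrier := N\<rparr>)"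
      "\<not> LinearCombinations.module.lin_dep R (M\<lparr>carrier := N\<rparr>) B" for B
    using that bound[of B] eq submodule.subset[OF N] by auto
  note rank = module_rank_is_max_lin_indpt[OF N' this]
  show "\<exists>B. finite B \<and> B \<subseteq> N \<and> \<not> M.lin_dep B \<and> card B = module_rank R (M\<lparr>carrier := N\<rparr>)"
    using rank(1) eq by auto
  show "card B \<le> module_rank R (M\<lparr>carrier := N\<rparr>)" if "finite B" "B \<subseteq> N" "\<not> M.lin_dep B"
    using rank(2)[of B] eq that by auto
qed

lemma common_kernel_submodule:
  assumes "module R L" "module R V" "\<F> \<subseteq> module_hom R L V"
  shows "submodule R {x \<in> carrier L. \<forall>f\<in>\<F>. f x = \<zero>\<^bsub>V\<^esub>} L"
proof -
  interpret L: module R L by fact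
  interpret V: module R V by fact
  have zero: "f \<zero>\<^bsub>L\<^esub> = \<zero>\<^bsub>V\<^esub>" if "f \<in> \<F>" for f
    using that assms(3) by (intro mod_hom.f0_is_0[of R]) (unfold_locales, auto)
  show ?thesis
  proof (rule submodule.intro[OF L.module_axioms])
    fix x y
    assume x: "x \<in> {x \<in> carrier L. \<forall>f\<in>\<F>. f x = \<zero>\<^bsub>V\<^esub>}" and y: "y \<in> {x \<in> carrier L. \<forall>f\<in>\<F>. f x = \<zero>\<^bsub>V\<^esub>}"
    have "f (x \<oplus>\<^bsub>L\<^esub> y) = \<zero>\<^bsub>V\<^esub>" if f: "f \<in> \<F>" for f
    proof -
      have "f x = \<zero>\<^bsub>V\<^esub>" "f y = \<zero>\<^bsub>V\<^esub>" using x y f by blast+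
      then show ?thesis using module_hom_add[OF subsetD[OF assms(3) f], of x y] x y by simp
    qed
    then show "x \<oplus>\<^bsub>L\<^esub> y \<in> {x \<in> carrier L. \<forall>f\<in>\<F>. f x = \<zero>\<^bsub>V\<^esub>}"
      using x y L.M.a_closed by blast
  next
    fix r x
    assume r: "r \<in> carrier R" and x: "x \<in> {x \<in> carrier L. \<forall>f\<in>\<F>. f x = \<zero>\<^bsub>V\<^esub>}"
    have "f (r \<odot>\<^bsub>L\<^esub> x) = \<zero>\<^bsub>V\<^esub>" if f: "f \<in> \<F>" for f
    proof -
      have "f x = \<zero>\<^bsub>V\<^esub>" using x f by blast
      then show ?thesis using module_hom_smult[OF subsetD[OF assms(3) f] r, of x] x r by simp
    qed
    then show "r \<odot>\<^bsub>L\<^esub> x \<in> {x \<in> carrier L. \<forall>f\<in>\<F>. f x = \<zero>\<^bsub>V\<^esub>}"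
      using r x L.smult_closed by blast
  qed (use zero in auto)
qed

text \<open>The vectors annihilated by all of \<open>B\<close> form a submodule containing \<open>B\<close>, hence containing its
  span; the same argument in the other variable passes from \<open>B\<close> to its span on the left.\<close>

lemma isotropic_span:
  assumes L: "module R L" and V: "module R V" and \<phi>: "bilinear_map R L V \<phi>"
    and B: "B \<subseteq> carrier L" "\<And>x y. x \<in> B \<Longrightarrow> y \<in> B \<Longrightarrow> \<phi> x y = \<zero>\<^bsub>V\<^esub>"
  shows "isotropic_submodule R L V \<phi> (LinearCombinations.module.span R L B)"
proof -
  interpret L: module R L by (rule L)
  have sub: "submodule R (L.span B) L" by (rule L.span_is_submodule[OF B(1)])
  have "submodule R {y \<in> carrier L. \<forall>f\<in>\<phi> ` B. f y = \<zero>\<^bsub>V\<^esub>} L"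
    using \<phi> B(1) by (intro common_kernel_submodule L V) (auto simp: bilinear_map_def)
  from L.span_is_subset[OF _ this, of B]
  have right: "\<phi> x y = \<zero>\<^bsub>V\<^esub>" if "x \<in> B" "y \<in> L.span B" for x y
    using that B by auto
  have "submodule R {x \<in> carrier L. \<forall>f\<in>(\<lambda>y x. \<phi> x y) ` L.span B. f x = \<zero>\<^bsub>V\<^esub>} L"
    using \<phi> submodule.subset[OF sub]
    by (intro common_kernel_submodule L V) (auto simp: bilinear_map_def)
  from L.span_is_subset[OF _ this, of B]
  have "\<phi> x y = \<zero>\<^bsub>V\<^esub>" if "x \<in> L.span B" "y \<in> L.span B" for x y
    using that B(1) right by auto
  then show ?thesis using sub unfolding isotropic_submodule_def by blast
qed

text \<open>An isotropic submodule of maximal rank contains an independent set of that size, on which \<open>\<phi>\<close>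
  vanishes; conversely the span of such a set is an isotropic submodule of at least that rank.
  Restating the index in this way turns the comparison of two maxima over submodules
  into the transport of one finite set.\<close>

lemma isotropy_index_is_max_lin_indpt:
  assumes L: "module R L" and V: "module R V" and \<phi>: "bilinear_map R L V \<phi>"
    and bound: "\<And>B. finite B \<Longrightarrow> B \<subseteq> carrier L \<Longrightarrow> \<not> LinearCombinations.module.lin_dep R L B
      \<Longrightarrow> card B \<le> n"
  shows "\<exists>B. finite B \<and> B \<subseteq> carrier L \<and> \<not> LinearCombinations.module.lin_dep R L B
      \<and> (\<forall>x\<in>B. \<forall>y\<in>B. \<phi> x y = \<zero>\<^bsub>V\<^esub>) \<and> card B = isotropy_index R L V \<phi>"
    and "finite B \<Longrightarrow> B \<subseteq> carrier L \<Longrightarrow> \<not> LinearCombinations.module.lin_dep R L B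
      \<Longrightarrow> (\<And>x y. x \<in> B \<Longrightarrow> y \<in> B \<Longrightarrow> \<phi> x y = \<zero>\<^bsub>V\<^esub>) \<Longrightarrow> card B \<le> isotropy_index R L V \<phi>"
proof -
  interpret L: module R L by (rule L)
  let ?I = "{module_rank R (L\<lparr>carrier := H\<rparr>) | H. isotropic_submodule R L V \<phi> H}"
  have basis: "\<exists>B. finite B \<and> B \<subseteq> H \<and> \<not> L.lin_dep B \<and> card B = module_rank R (L\<lparr>carrier := H\<rparr>)"
    and sub: "H \<subseteq> carrier L" if "isotropic_submodule R L V \<phi> H" for H
    using submodule_rank_is_max_lin_indpt(1)[OF L _ bound] that
    unfolding isotropic_submodule_def submodule_def by auto
  have "k \<le> n" if k: "k \<in> ?I" for k
  proof -
    obtain H where H: "isotropic_submodule R L V \<phi> H" "k = module_rank R (L\<lparr>carrier := H\<rparr>)"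
      using k by blast
    then show ?thesis using basis[OF H(1)] sub[OF H(1)] bound by (metis subset_trans)
  qed
  then have fin: "finite ?I" by (intro finite_subset[of ?I "{..n}"]) auto
  have "?I \<noteq> {}" using isotropic_span[OF L V \<phi>, of "{}"] by blast
  then have "isotropy_index R L V \<phi> \<in> ?I" unfolding isotropy_index_def by (rule Max_in[OF fin])
  then obtain H where H: "isotropic_submodule R L V \<phi> H"
      "isotropy_index R L V \<phi> = module_rank R (L\<lparr>carrier := H\<rparr>)" by blast
  obtain D where "finite D" "D \<subseteq> H" "\<not> L.lin_dep D" "card D = module_rank R (L\<lparr>carrier := H\<rparr>)"
    using basis[OF H(1)] by blast
  then show "\<exists>B. finite B \<and> B \<subseteq> carrier L \<and> \<not> L.lin_dep B
      \<and> (\<forall>x\<in>B. \<forall>y\<in>B. \<phi> x y = \<zero>\<^bsub>V\<^esub>) \<and> card B = isotropy_index R L V \<phi>"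
    using H sub[OF H(1)] unfolding isotropic_submodule_def by (intro exI[of _ D]) auto
  show "card B \<le> isotropy_index R L V \<phi>"
    if B: "finite B" "B \<subseteq> carrier L" "\<not> L.lin_dep B"
      and \<phi>B: "\<And>x y. x \<in> B \<Longrightarrow> y \<in> B \<Longrightarrow> \<phi> x y = \<zero>\<^bsub>V\<^esub>"
  proof -
    have iso: "isotropic_submodule R L V \<phi> (L.span B)"
      using isotropic_span[OF L V \<phi> B(2)] \<phi>B by blast
    have "card B \<le> module_rank R (L\<lparr>carrier := L.span B\<rparr>)"
      using B by (intro submodule_rank_is_max_lin_indpt(2)[OF L _ bound] L.in_own_span
          L.span_is_submodule) auto
    also have "\<dots> \<le> isotropy_index R L V \<phi>"
      unfolding isotropy_index_def using iso by (intro Max_ge fin) auto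
    finally show ?thesis .
  qed
qed

theorem proposition8:
  fixes R' R :: "('r, 'm) ring_scheme" and K :: "'r set"
    and L :: "('r, 'a, 'n) module_scheme" and V :: "('r, 'b, 'p) module_scheme"
    and \<phi> :: "'a \<Rightarrow> 'a \<Rightarrow> 'b"
  assumes "field R'" and "subring K R'" and "R = R'\<lparr>carrier := K\<rparr>"
    and "field R \<or> \<Z> \<simeq> R"
    and "finitely_generated_module R L" and "finitely_generated_module R V"
    and "bilinear_map R L V \<phi>" and "skew_symmetric_map L V \<phi>"
  shows "isotropy_index R L V \<phi>
    \<le> isotropy_index R' (scalar_extension R R' L) (scalar_extension R R' V) (induced_map R R' V \<phi>)"
proof -
  interpret R': field R' by fact
  have L: "module R L" and V: "module R V"
    using assms(5,6) unfolding finitely_generated_module_def by auto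
  have KR': "carrier R \<subseteq> carrier R'" using subringE(1)[OF assms(2)] assms(3) by simp
  have ext: "scalar_extension_setup R' R L" "scalar_extension_setup R' R V"
    by (intro scalar_extension_setup.intro scalar_extension_setup_axioms.intro
        R'.cring_axioms L V KR')+
  interpret \<phi>: induced_map_setup R' R L V \<phi>
    by (intro induced_map_setup.intro induced_map_setup_axioms.intro ext assms(7))
  interpret L: extension_to_field R' R L K
    by (intro extension_to_field.intro extension_to_field_axioms.intro ext(1) assms(1-3))
  let ?\<iota> = "pure_tensor R R' L \<one>\<^bsub>R'\<^esub>"
  obtain A where A: "finite A" "A \<subseteq> carrier L" "LinearCombinations.module.span R L A = carrier L"
    using assms(5) unfolding finitely_generated_module_def by blast
  obtain B where B: "finite B" "B \<subseteq> carrier L" "\<not> LinearCombinations.module.lin_dep R L B"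
      and \<phi>B: "\<forall>x\<in>B. \<forall>y\<in>B. \<phi> x y = \<zero>\<^bsub>V\<^esub>" and card: "card B = isotropy_index R L V \<phi>"
    using isotropy_index_is_max_lin_indpt(1)[OF L V assms(7) L.lin_indpt_bounded(2)[OF A]] by blast
  have iso: "\<phi>.\<psi> u v = \<zero>\<^bsub>\<phi>.V.E\<^esub>" if uv: "u \<in> ?\<iota> ` B" "v \<in> ?\<iota> ` B" for u v
  proof -
    obtain x y where x: "x \<in> B" "u = ?\<iota> x" and y: "y \<in> B" "v = ?\<iota> y" using uv by blast
    have "\<phi>.\<psi> u v = pure_tensor R R' V \<one>\<^bsub>R'\<^esub> \<zero>\<^bsub>V\<^esub>"
      using \<phi>.induced_map_pure_tensor[of "\<one>\<^bsub>R'\<^esub>" x "\<one>\<^bsub>R'\<^esub>" y] x y B(2) \<phi>B by auto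
    then show ?thesis using \<phi>.V.pure_tensor_zero_right[OF R'.one_closed] by (rule trans)
  qed
  have "card B = card (?\<iota> ` B)"
    using card_image[OF L.pure_tensors_lin_indpt(1)[OF A B]] by simp
  also have "\<dots> \<le> isotropy_index R' \<phi>.L.E \<phi>.V.E \<phi>.\<psi>"
  proof (rule isotropy_index_is_max_lin_indpt(2)[OF \<phi>.L.scalar_extension_module
        \<phi>.V.scalar_extension_module \<phi>.induced_map_bilinear L.lin_indpt_bounded(1)[OF A]])
    show "finite (?\<iota> ` B)" using B(1) by simp
    show "?\<iota> ` B \<subseteq> carrier \<phi>.L.E"
      using B(2) \<phi>.L.pure_tensor_closed[OF R'.one_closed] by blast
    show "\<not> LinearCombinations.module.lin_dep R' \<phi>.L.E (?\<iota> ` B)"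
      by (rule L.pure_tensors_lin_indpt(2)[OF A B])
  qed (rule iso | assumption)+
  finally show ?thesis using card by simp
qed

end
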